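(* Let $n\in\{5,7,9\}$. Any two (not necessarily finite) nilpotent $n$-centralizer groups are isoclinic.
   Context: $\mathrm{Cent}(G)=\{C_G(x): x\in G\}$ is the set of centralizers of elements of $G$; $G$ is $n$-centralizer if $|\mathrm{Cent}(G)|=n$. Two groups $G$ and $H$ are isoclinic if there are isomorphisms $\varphi:G/Z(G)\to H/Z(H)$ and $\phi:G'\to H'$ (where $'$ denotes the commutator subgroup) such that whenever $\varphi(g_iZ(G))=h_iZ(H)$ for $i=1,2$ ($g_i\in G$, $h_i\in H$), one has $\phi([g_1,g_2])=[h_1,h_2]$. *)

theory Defs
  imports "HOL-Algebra.Algebra"
begin

definition group_center :: "('a, 'b) monoid_scheme \<Rightarrow> 'a set" where
  "group_center G = {z \<in> carrier G. \<forall>g \<in> carrier G. z \<otimes>\<^bsub>G\<^esub> g = g \<otimes>\<^bsub>G\<^esub> z}"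

definition centralizer :: "('a, 'b) monoid_scheme \<Rightarrow> 'a \<Rightarrow> 'a set" where
  "centralizer G x = {g \<in> carrier G. g \<otimes>\<^bsub>G\<^esub> x = x \<otimes>\<^bsub>G\<^esub> g}"

definition Cent :: "('a, 'b) monoid_scheme \<Rightarrow> 'a set set" where
  "Cent G = centralizer G ` carrier G"

definition n_centralizer :: "nat \<Rightarrow> ('a, 'b) monoid_scheme \<Rightarrow> bool" where
  "n_centralizer n G \<longleftrightarrow> finite (Cent G) \<and> card (Cent G) = n"

text \<open>The convention for commutators is the one built into \<^const>\<open>derived\<close>.\<close>

definition commutator :: "('a, 'b) monoid_scheme \<Rightarrow> 'a \<Rightarrow> 'a \<Rightarrow> 'a" where
  "commutator G x y = x \<otimes>\<^bsub>G\<^esub> y \<otimes>\<^bsub>G\<^esub> inv\<^bsub>G\<^esub> x \<otimes>\<^bsub>G\<^esub> inv\<^bsub>G\<^esub> y"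

text \<open>Indexing starts at \<open>0\<close>: \<open>lower_central G 0\<close> is the whole group, and
  \<open>lower_central G 1\<close> is its commutator subgroup.\<close>

primrec lower_central :: "('a, 'b) monoid_scheme \<Rightarrow> nat \<Rightarrow> 'a set" where
  "lower_central G 0 = carrier G"
| "lower_central G (Suc i) =
     generate G {commutator G x y | x y. x \<in> lower_central G i \<and> y \<in> carrier G}"

definition nilpotent_group :: "('a, 'b) monoid_scheme \<Rightarrow> bool" where
  "nilpotent_group G \<longleftrightarrow> group G \<and> (\<exists>c. lower_central G c = {\<one>\<^bsub>G\<^esub>})"

definition isoclinic ::
  "('a, 'c) monoid_scheme \<Rightarrow> ('b, 'd) monoid_scheme \<Rightarrow> bool" where
  "isoclinic G H \<longleftrightarrow>
    (\<exists>\<phi> \<in> iso (G Mod group_center G) (H Mod group_center H).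
     \<exists>\<psi> \<in> iso (G\<lparr>carrier := derived G (carrier G)\<rparr>) (H\<lparr>carrier := derived H (carrier H)\<rparr>).
       \<forall>g\<^sub>1 \<in> carrier G. \<forall>g\<^sub>2 \<in> carrier G. \<forall>h\<^sub>1 \<in> carrier H. \<forall>h\<^sub>2 \<in> carrier H.
         \<phi> (group_center G #>\<^bsub>G\<^esub> g\<^sub>1) = group_center H #>\<^bsub>H\<^esub> h\<^sub>1 \<longrightarrow>
         \<phi> (group_center G #>\<^bsub>G\<^esub> g\<^sub>2) = group_center H #>\<^bsub>H\<^esub> h\<^sub>2 \<longrightarrow>
         \<psi> (commutator G g\<^sub>1 g\<^sub>2) = commutator H h\<^sub>1 h\<^sub>2)"

end

theory Submission
  imports Defs "HOL-Number_Theory.Cong"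
begin

text \<open>
  Finitely many centralizers force the center \<open>Z\<close> to have finite index. If there are at most \<open>9\<close>
  of them, then every proper centralizer is abelian, by counting cosets of \<open>Z\<close>; the proper
  centralizers then partition \<open>G - Z\<close>. Nilpotency provides \<open>x\<close> in the second center, outside \<open>Z\<close>,
  with \<open>x\<^sup>p \<in> Z\<close> for a prime \<open>p\<close>. With \<open>M = C(x)\<close>, the \<open>n - 2\<close> centralizers that differ from \<open>G\<close>
  and \<open>M\<close> cover \<open>G - M\<close>. Each index over \<open>Z\<close> is divisible by \<open>p\<close>, so counting cosets gives
  \<open>p dvd n - 2\<close>, and \<open>n - 2\<close> is prime, so \<open>p = n - 2\<close>. Hence the centralizers of \<open>h x\<^sup>i\<close> for \<open>i < p\<close>
  are all of them, for every \<open>h \<notin> M\<close>, and this forces \<open>G = \<langle>x, g\<rangle> Z\<close>. Consequently \<open>G / Z\<close> is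
  elementary abelian of order \<open>p\<^sup>2\<close>, the commutator map is a determinant with values in a group of
  order \<open>p\<close>, and the isoclinism class depends on \<open>p\<close> only.
\<close>

section \<open>Center, centralizers and cosets of the center\<close>

context group
begin

abbreviation Z where "Z \<equiv> group_center G"

abbreviation C where "C \<equiv> centralizer G"

lemma group_center_iff: "z \<in> Z \<longleftrightarrow> z \<in> carrier G \<and> (\<forall>g \<in> carrier G. z \<otimes> g = g \<otimes> z)"
  by (simp add: group_center_def)

lemma group_center_closed: "z \<in> Z \<Longrightarrow> z \<in> carrier G"
  by (simp add: group_center_def)

lemma group_center_comm: "z \<in> Z \<Longrightarrow> g \<in> carrier G \<Longrightarrow> z \<otimes> g = g \<otimes> z"
  by (simp add: group_center_def)

lemma centralizer_iff: "g \<in> C x \<longleftrightarrow> g \<in> carrier G \<and> g \<otimes> x = x \<otimes> g"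
  by (simp add: centralizer_def)

lemma centralizer_closed: "g \<in> C x \<Longrightarrow> g \<in> carrier G"
  by (simp add: centralizer_def)

lemma centralizer_sym: "x \<in> carrier G \<Longrightarrow> g \<in> C x \<Longrightarrow> x \<in> C g"
  by (simp add: centralizer_def)

lemma subgroup_centralizer:
  assumes x: "x \<in> carrier G"
  shows "subgroup (C x) G"
proof (rule subgroupI)
  show "C x \<subseteq> carrier G" by (auto simp: centralizer_def)
  have "\<one> \<in> C x" using x by (simp add: centralizer_def)
  then show "C x \<noteq> {}" by blast
next
  fix a assume "a \<in> C x"
  then have a: "a \<in> carrier G" and ax: "a \<otimes> x = x \<otimes> a" by (auto simp: centralizer_def)
  have "inv a \<otimes> x = inv a \<otimes> (x \<otimes> a) \<otimes> inv a" using a x by (simp add: m_assoc)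
  also have "\<dots> = inv a \<otimes> (a \<otimes> x) \<otimes> inv a" by (simp add: ax)
  also have "\<dots> = x \<otimes> inv a" using a x by (simp add: m_assoc[symmetric])
  finally show "inv a \<in> C x" using a by (simp add: centralizer_def)
next
  fix a b assume "a \<in> C x" "b \<in> C x"
  then have a: "a \<in> carrier G" "a \<otimes> x = x \<otimes> a" and b: "b \<in> carrier G" "b \<otimes> x = x \<otimes> b"
    by (auto simp: centralizer_def)
  have "a \<otimes> b \<otimes> x = a \<otimes> x \<otimes> b" using a b x by (metis a(2) m_assoc)
  also have "\<dots> = x \<otimes> (a \<otimes> b)" using a b x by (simp add: a(2) m_assoc[symmetric])
  finally show "a \<otimes> b \<in> C x" using a b by (simp add: centralizer_def)
qed

lemma group_center_eq_INT: "Z = carrier G \<inter> (\<Inter>x\<in>carrier G. C x)"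
  by (auto simp: group_center_def centralizer_def)

lemma subgroup_group_center: "subgroup Z G"
proof -
  have "Z = \<Inter> (insert (carrier G) (C ` carrier G))"
    by (auto simp: group_center_eq_INT)
  moreover have "subgroup (\<Inter> (insert (carrier G) (C ` carrier G))) G"
    by (rule subgroups_Inter) (auto intro: subgroup_centralizer subgroup_self)
  ultimately show ?thesis by simp
qed

lemma normal_group_center: "Z \<lhd> G"
  unfolding normal_inv_iff
  using subgroup_group_center
  by (auto simp: group_center_comm group_center_closed[THEN group_center_comm[rotated]] m_assoc[symmetric])
     (metis group_center_closed group_center_comm inv_closed inv_solve_right' m_assoc r_inv r_one m_closed)

text \<open>If \<open>h = z \<otimes> g\<close> with \<open>z\<close> central, then
  \<open>inv g \<otimes> h\<close> is again \<open>z\<close>. So right cosets of the center can be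
  tested by left quotients, the form that suits left translation.\<close>

lemma rcos_center_eq_iff:
  assumes "g \<in> carrier G" "h \<in> carrier G"
  shows "Z #> g = Z #> h \<longleftrightarrow> inv g \<otimes> h \<in> Z"
proof
  assume "Z #> g = Z #> h"
  then have "h \<in> Z #> g" using assms rcos_self subgroup_group_center by blast
  then obtain z where z: "z \<in> Z" "h = z \<otimes> g" by (auto simp: r_coset_def)
  then have "inv g \<otimes> h = z"
    using assms group_center_closed group_center_comm inv_solve_left m_closed by metis
  then show "inv g \<otimes> h \<in> Z" using z by simp
next
  assume *: "inv g \<otimes> h \<in> Z"
  have "h = (inv g \<otimes> h) \<otimes> g"
    using group_center_comm[OF * assms(1)] assms by (simp add: m_assoc[symmetric])
  then have "h \<in> Z #> g" using * by (auto simp: r_coset_def)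
  then show "Z #> g = Z #> h" using assms repr_independence subgroup_group_center by blast
qed

lemma centralizer_mult_center:
  assumes "g \<in> carrier G" "z \<in> Z"
  shows "C (g \<otimes> z) = C g"
proof -
  have z: "z \<in> carrier G" using assms group_center_closed by blast
  have "h \<otimes> (g \<otimes> z) = (g \<otimes> z) \<otimes> h \<longleftrightarrow> h \<otimes> g = g \<otimes> h" if h: "h \<in> carrier G" for h
  proof -
    have "h \<otimes> (g \<otimes> z) = (h \<otimes> g) \<otimes> z" using h z assms by (simp add: m_assoc)
    moreover have "(g \<otimes> z) \<otimes> h = (g \<otimes> h) \<otimes> z"
      using h z assms group_center_comm[OF assms(2) h] by (simp add: m_assoc)
    ultimately show ?thesis using h z assms by simp
  qed
  then show ?thesis by (auto simp: centralizer_def)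
qed

lemma centralizer_eq_carrier_iff: "x \<in> carrier G \<Longrightarrow> C x = carrier G \<longleftrightarrow> x \<in> Z"
  unfolding centralizer_def group_center_def by (auto dest: sym)

lemma center_subset_centralizer: "x \<in> carrier G \<Longrightarrow> Z \<subseteq> C x"
  by (auto simp: centralizer_def group_center_def)

section \<open>Finite index of the center\<close>

text \<open>If \<open>C(g) = C(h)\<close> and \<open>C(g y) = C(h y)\<close>, then \<open>g\<^sup>-\<^sup>1 h\<close> commutes with \<open>y\<close>. So the finitely
  many values \<open>C(g y)\<close>, with \<open>y\<close> one representative for each centralizer, determine \<open>Z g\<close>.\<close>

lemma finite_rcosets_center:
  assumes "finite (Cent G)"
  shows "finite ((#>) Z ` carrier G)"
proof -
  define r where "r D = (SOME y. y \<in> carrier G \<and> C y = D)" for D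
  have r: "r D \<in> carrier G" "C (r D) = D" if "D \<in> Cent G" for D
    using that someI_ex[of "\<lambda>y. y \<in> carrier G \<and> C y = D"]
    unfolding r_def Cent_def by blast+
  \<comment> \<open>\<open>restrict\<close> puts \<open>F g\<close> into the space of extensional
    functions from \<open>Cent G\<close> to itself, which is finite.\<close>
  define F where "F g = restrict (\<lambda>D. C (g \<otimes> r D)) (Cent G)" for g
  have fin: "finite (F ` carrier G)"
  proof (rule finite_subset)
    show "F ` carrier G \<subseteq> (\<Pi>\<^sub>E D \<in> Cent G. Cent G)"
      using r by (auto simp: F_def Cent_def)
    show "finite (\<Pi>\<^sub>E D \<in> Cent G. Cent G)" using assms by (simp add: finite_PiE)
  qed
  have key: "Z #> g = Z #> h"
    if g: "g \<in> carrier G" and h: "h \<in> carrier G" and eq: "F g = F h" for g h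
  proof -
    have FD: "C (g \<otimes> r D) = C (h \<otimes> r D)" if "D \<in> Cent G" for D
      using fun_cong[OF eq, of D] that by (simp add: F_def)
    \<comment> \<open>The entry of \<open>F g\<close> at \<open>carrier G\<close> uses a central
      representative, so it is \<open>C g\<close> itself.\<close>
    have "carrier G \<in> Cent G"
      using centralizer_eq_carrier_iff[of \<one>] by (auto simp: Cent_def group_center_def)
    then have "C g = C h"
      using FD[of "carrier G"] r[of "carrier G"] centralizer_eq_carrier_iff centralizer_mult_center g h
      by metis
    then have gh: "g \<otimes> h = h \<otimes> g" using g by (auto simp: centralizer_def)
    have "inv g \<otimes> h \<in> C x" if x: "x \<in> carrier G" for x
    proof -
      let ?y = "r (C x)"
      have "C x \<in> Cent G" using x by (simp add: Cent_def)
      note y = r[OF this] and CF = FD[OF this]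
      have "g \<otimes> ?y \<in> C (h \<otimes> ?y)" using CF g y by (auto simp: centralizer_def)
      then have "g \<otimes> ?y \<otimes> (h \<otimes> ?y) = h \<otimes> ?y \<otimes> (g \<otimes> ?y)" by (simp add: centralizer_def)
      \<comment> \<open>The last \<open>?y\<close> cancels. Multiplying by \<open>inv g\<close> on
        both sides then leaves a relation between \<open>?y\<close> and the quotient of
        \<open>g\<close> and \<open>h\<close>, since \<open>g\<close> and \<open>h\<close>
        commute.\<close>
      then have "g \<otimes> ?y \<otimes> h = h \<otimes> ?y \<otimes> g" using g h y(1) by (simp add: m_assoc[symmetric])
      then have "inv g \<otimes> (g \<otimes> ?y \<otimes> h) \<otimes> inv g = inv g \<otimes> (h \<otimes> ?y \<otimes> g) \<otimes> inv g" by simp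
      then have "?y \<otimes> (h \<otimes> inv g) = inv g \<otimes> h \<otimes> ?y"
        using g h y(1) by (simp add: m_assoc[symmetric]) (simp add: m_assoc)
      moreover have "h \<otimes> inv g = inv g \<otimes> h"
        using gh g h by (metis inv_closed inv_solve_left inv_solve_right m_assoc m_closed)
      ultimately have "inv g \<otimes> h \<in> C ?y" using g h by (simp add: centralizer_def)
      then show ?thesis using y by simp
    qed
    then have "inv g \<otimes> h \<in> Z" using g h by (simp add: group_center_eq_INT)
    then show ?thesis using g h by (simp add: rcos_center_eq_iff)
  qed
  \<comment> \<open>By \<open>key\<close> the coset of \<open>g\<close> depends on
    \<open>F g\<close> only, so the coset map factors through the finite set of values of
    \<open>F\<close>.\<close>
  define P where "P w = Z #> (SOME g. g \<in> carrier G \<and> F g = w)" for w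
  have "Z #> g = P (F g)" if "g \<in> carrier G" for g
    using someI[of "\<lambda>h. h \<in> carrier G \<and> F h = F g" g] that unfolding P_def
    by (metis (mono_tags, lifting) key)
  then have "(#>) Z ` carrier G \<subseteq> P ` F ` carrier G" by auto
  then show ?thesis using fin finite_surj by blast
qed

end

section \<open>Counting cosets of the center\<close>

text \<open>On \<open>S\<close> the map \<open>f\<close> is a function of \<open>h\<close>, so its
  image is an image of that of \<open>h\<close>. Used in both directions to equate two coset
  counts.\<close>

lemma card_image_le_if_factors:
  assumes "finite (h ` S)" and "\<And>x y. x \<in> S \<Longrightarrow> y \<in> S \<Longrightarrow> h x = h y \<Longrightarrow> f x = f y"
  shows "card (f ` S) \<le> card (h ` S)"
proof -
  define k where "k w = f (inv_into S h w)" for w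
  have "f x = k (h x)" if "x \<in> S" for x
    unfolding k_def using that by (intro assms(2)) (simp_all add: inv_into_into f_inv_into_f)
  then have "f ` S = (\<lambda>x. k (h x)) ` S" by (rule image_cong[OF refl])
  then have "f ` S = k ` h ` S" unfolding image_image .
  then show ?thesis using card_image_le[OF assms(1), of k] by simp
qed

context group
begin

lemma inv_mult_cancel:
  assumes "g \<in> carrier G" "y \<in> carrier G"
  shows "inv g \<otimes> (g \<otimes> y) = y" "g \<otimes> (inv g \<otimes> y) = y"
  using assms by (simp_all add: m_assoc[symmetric])

text \<open>For a subgroup that contains \<open>Z\<close> this is its index over \<open>Z\<close>.
  Arbitrary sets are allowed because the pieces counted later need not be subgroups. Infinite counts
  give \<open>0\<close>, so the lemmas on sizes assume finitely many cosets.\<close>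

definition center_index :: "'a set \<Rightarrow> nat" where
  "center_index S = card ((#>) Z ` S)"

lemma center_index_mono:
  assumes "finite ((#>) Z ` carrier G)" "S \<subseteq> S'" "S' \<subseteq> carrier G"
  shows "center_index S \<le> center_index S'"
  unfolding center_index_def using assms by (meson card_mono finite_subset image_mono)

lemma center_index_pos:
  assumes "finite ((#>) Z ` carrier G)" "S \<subseteq> carrier G" "S \<noteq> {}"
  shows "center_index S > 0"
  unfolding center_index_def using assms by (meson card_gt_0_iff finite_subset image_is_empty image_mono)

text \<open>Left translation by \<open>g\<close> leaves the quotients
  \<open>inv x \<otimes> y\<close> unchanged, so it identifies the same elements modulo
  \<open>Z\<close>.\<close>

lemma center_index_translate:
  assumes fin: "finite ((#>) Z ` carrier G)" and g: "g \<in> carrier G" and S: "S \<subseteq> carrier G"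
  shows "center_index ((\<otimes>) g ` S) = center_index S"
proof -
  have eq: "Z #> (g \<otimes> x) = Z #> (g \<otimes> y) \<longleftrightarrow> Z #> x = Z #> y" if "x \<in> S" "y \<in> S" for x y
  proof -
    have "x \<in> carrier G" "y \<in> carrier G" using that S by auto
    moreover from this have "inv (g \<otimes> x) \<otimes> (g \<otimes> y) = inv x \<otimes> y"
      using g by (simp add: inv_mult_group m_assoc inv_mult_cancel)
    ultimately show ?thesis using g by (simp add: rcos_center_eq_iff)
  qed
  have im: "(#>) Z ` (\<otimes>) g ` S = (\<lambda>x. Z #> (g \<otimes> x)) ` S" by auto
  have "finite ((#>) Z ` (\<otimes>) g ` S)" "finite ((#>) Z ` S)"
    using S g by (auto intro!: finite_subset[OF _ fin])
  then show ?thesis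
    unfolding center_index_def im
    using card_image_le_if_factors[of "(#>) Z" S "\<lambda>x. Z #> (g \<otimes> x)"]
      card_image_le_if_factors[of "\<lambda>x. Z #> (g \<otimes> x)" S "(#>) Z"] eq
    by (simp add: antisym)
qed

lemma center_index_group_center: "center_index Z = 1"
proof -
  have "(#>) Z ` Z = {Z}"
    using subgroup_group_center subgroup.one_closed[OF subgroup_group_center]
    by (force simp: coset_join2 group_center_closed)
  then show ?thesis by (simp add: center_index_def)
qed

text \<open>The elements of \<open>L\<close> represent different left cosets of \<open>B\<close>
  inside \<open>M\<close>. Each of them consists of \<open>center_index B\<close> cosets of
  \<open>Z\<close>, and none is shared because \<open>B\<close> contains \<open>Z\<close>.\<close>

lemma card_mult_center_index_le:
  assumes fin: "finite ((#>) Z ` carrier G)"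
    and B: "subgroup B G" "Z \<subseteq> B" and M: "subgroup M G" "B \<subseteq> M"
    and L: "finite L" "L \<subseteq> M"
    and sep: "\<And>u v. u \<in> L \<Longrightarrow> v \<in> L \<Longrightarrow> u \<noteq> v \<Longrightarrow> inv u \<otimes> v \<notin> B"
  shows "card L * center_index B \<le> center_index M"
proof -
  let ?W = "\<lambda>u. (#>) Z ` (\<otimes>) u ` B"
  have Bc: "B \<subseteq> carrier G" and Mc: "M \<subseteq> carrier G" using B M subgroup.subset by blast+
  then have Lc: "L \<subseteq> carrier G" using L by blast
  have finW: "finite (?W u)" if "u \<in> L" for u
    using that Lc Bc by (auto intro!: finite_subset[OF _ fin])
  have disj: "?W u \<inter> ?W v = {}" if uv: "u \<in> L" "v \<in> L" "u \<noteq> v" for u v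
  proof (rule ccontr)
    assume "?W u \<inter> ?W v \<noteq> {}"
    then obtain b b' where b: "b \<in> B" "b' \<in> B" "Z #> (u \<otimes> b) = Z #> (v \<otimes> b')" by auto
    have c: "u \<in> carrier G" "v \<in> carrier G" "b \<in> carrier G" "b' \<in> carrier G"
      using uv b Lc Bc by auto
    have "inv (u \<otimes> b) \<otimes> (v \<otimes> b') \<in> B" using b c B by (auto simp: rcos_center_eq_iff)
    then have "b \<otimes> (inv (u \<otimes> b) \<otimes> (v \<otimes> b')) \<otimes> inv b' \<in> B"
      using b B by (meson subgroup.m_closed subgroup.m_inv_closed)
    moreover have "b \<otimes> (inv (u \<otimes> b) \<otimes> (v \<otimes> b')) \<otimes> inv b' = inv u \<otimes> v"
      using c by (simp add: inv_mult_group m_assoc inv_mult_cancel)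
    ultimately show False using sep uv by auto
  qed
  have "card L * center_index B = (\<Sum>u\<in>L. card (?W u))"
    using Lc center_index_translate[OF fin _ Bc] unfolding center_index_def
    by (simp add: subset_iff)
  also have "\<dots> = card (\<Union>u\<in>L. ?W u)"
    by (rule card_UN_disjoint[symmetric]) (use L finW disj in auto)
  also have "\<dots> \<le> card ((#>) Z ` M)"
  proof (rule card_mono)
    show "finite ((#>) Z ` M)" using Mc by (auto intro!: finite_subset[OF _ fin])
    show "(\<Union>u\<in>L. ?W u) \<subseteq> (#>) Z ` M"
      using L M B by (auto intro!: imageI subgroup.m_closed)
  qed
  finally show ?thesis by (simp add: center_index_def)
qed

section \<open>Proper centralizers are abelian\<close>

text \<open>Suppose \<open>M = C(x)\<close> contains \<open>a, b\<close> that do not commute. Then \<open>G, M, C(a), C(b), C(a b)\<close> are five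
  centralizers that contain \<open>x\<close>, so at most four, forming \<open>T\<close>, do not. For \<open>g \<notin> M\<close> the sets
  \<open>E t = {m \<in> M. C(g m) = t}\<close> with \<open>t \<in> T\<close> cover \<open>M\<close>, and each lies in a coset of a subgroup \<open>B t\<close> of
  index at least \<open>4\<close> in \<open>M\<close>. So \<open>T\<close> has four elements, no further centralizer contains \<open>x\<close>, and this
  forces \<open>B t = Z\<close>. But then \<open>M\<close> has at most four cosets of \<open>Z\<close>, although \<open>1, x, a, x a, b\<close> lie in
  different ones.\<close>

lemma centralizer_abelian:
  assumes fin: "finite (Cent G)" and card9: "card (Cent G) \<le> 9"
    and x: "x \<in> carrier G" "x \<notin> Z" and a: "a \<in> C x" and b: "b \<in> C x"
  shows "a \<otimes> b = b \<otimes> a"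
proof (rule ccontr)
  assume ab: "a \<otimes> b \<noteq> b \<otimes> a"
  define M where "M = C x"
  have fi: "finite ((#>) Z ` carrier G)" using finite_rcosets_center[OF fin] .
  have M: "subgroup M G" using x subgroup_centralizer by (simp add: M_def)
  have Mc: "M \<subseteq> carrier G" using M subgroup.subset by blast
  have ac: "a \<in> carrier G" and bc: "b \<in> carrier G" using a b centralizer_closed by auto
  have aM: "a \<in> M" and bM: "b \<in> M" using a b by (simp_all add: M_def)
  have abM: "a \<otimes> b \<in> M" by (rule subgroup.m_closed[OF M aM bM])
  have xM: "x \<in> M" using x by (simp add: M_def centralizer_def)
  have xcomm: "m \<otimes> x = x \<otimes> m" if "m \<in> M" for m using that by (simp add: M_def centralizer_def)
  have xC: "x \<in> C m \<longleftrightarrow> m \<in> M" if "m \<in> carrier G" for m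
    using that x by (auto simp: M_def centralizer_def)
  have a_ab: "a \<notin> C (a \<otimes> b)"
  proof
    assume "a \<in> C (a \<otimes> b)"
    then have "a \<otimes> (a \<otimes> b) = a \<otimes> (b \<otimes> a)" using ac bc by (simp add: centralizer_def m_assoc)
    then show False using ab ac bc by simp
  qed
  have b_ab: "b \<notin> C (a \<otimes> b)"
  proof
    assume "b \<in> C (a \<otimes> b)"
    then have "(b \<otimes> a) \<otimes> b = (a \<otimes> b) \<otimes> b" using ac bc by (simp add: centralizer_def m_assoc)
    then show False using ab ac bc by (metis m_closed r_cancel)
  qed
  have a_b: "a \<notin> C b" "b \<notin> C a" using ab by (auto simp: centralizer_def)
  define N where "N = {carrier G, M, C a, C b, C (a \<otimes> b)}"
  have self: "m \<in> C m" if "m \<in> carrier G" for m using that by (simp add: centralizer_def)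
  have MneG: "M \<noteq> carrier G" using x centralizer_eq_carrier_iff by (simp add: M_def)
  have CaG: "C a \<noteq> carrier G" "C a \<noteq> M" using a_b bc bM by auto
  have CbG: "C b \<noteq> carrier G" "C b \<noteq> M" using a_b ac aM by auto
  have CabG: "C (a \<otimes> b) \<noteq> carrier G" "C (a \<otimes> b) \<noteq> M" using a_ab ac aM by auto
  have Cne: "C a \<noteq> C b" "C a \<noteq> C (a \<otimes> b)" "C b \<noteq> C (a \<otimes> b)"
    using a_b a_ab b_ab self ac bc by blast+
  have cardN: "card N = 5"
    unfolding N_def using MneG CaG CbG CabG Cne by (simp add: card_insert_if eq_commute)
  have G_Cent: "carrier G \<in> Cent G"
    using centralizer_eq_carrier_iff[of \<one>] by (auto simp: Cent_def group_center_def)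
  define K where "K = {D \<in> Cent G. x \<in> D}"
  define T where "T = {D \<in> Cent G. x \<notin> D}"
  have in_K: "C m \<in> K" if "m \<in> M" for m
  proof -
    have "m \<in> carrier G" using that Mc by blast
    then show ?thesis using xC that by (simp add: K_def Cent_def)
  qed
  have NK: "N \<subseteq> K"
    using G_Cent x(1) in_K[OF aM] in_K[OF bM] in_K[OF abM] in_K[OF xM]
    unfolding N_def M_def[symmetric] by (simp add: K_def)
  have finK: "finite K" and finT: "finite T" using fin by (auto simp: K_def T_def)
  have "Cent G = K \<union> T" "K \<inter> T = {}" by (auto simp: K_def T_def)
  then have KT: "card K + card T \<le> 9" using card9 card_Un_disjoint[OF finK finT] by simp
  have cardK: "5 \<le> card K" using card_mono[OF finK NK] cardN by simp
  obtain g where g: "g \<in> carrier G" "g \<notin> M" using MneG Mc by blast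
  define E where "E t = {m \<in> M. C (g \<otimes> m) = t}" for t
  \<comment> \<open>The part after \<open>M\<close> is the center of the subgroup
    \<open>t\<close>.\<close>
  define B where "B t = M \<inter> (t \<inter> (\<Inter>y\<in>t. C y))" for t
  have gmM: "g \<otimes> m \<notin> M" if "m \<in> M" for m
  proof
    assume "g \<otimes> m \<in> M"
    from subgroup.m_closed[OF M this subgroup.m_inv_closed[OF M that]]
    show False using g subsetD[OF Mc that] by (simp add: m_assoc)
  qed
  have T_eq: "C (g \<otimes> m) \<in> T" if "m \<in> M" for m
  proof -
    have "g \<otimes> m \<in> carrier G" using that g Mc by auto
    then show ?thesis using gmM[OF that] xC by (simp add: T_def Cent_def)
  qed
  have ME: "M = (\<Union>t\<in>T. E t)" using T_eq by (auto simp: E_def)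
  have cMle: "center_index M \<le> (\<Sum>t\<in>T. center_index (E t))"
  proof -
    have "(#>) Z ` M = (\<Union>t\<in>T. (#>) Z ` E t)" by (subst ME) auto
    then show ?thesis unfolding center_index_def using card_UN_le[OF finT] by simp
  qed
  have cMpos: "center_index M > 0" using center_index_pos[OF fi Mc] xM by blast
  have E_le: "center_index (E t) \<le> center_index (B t)"
    and BZ: "Z \<subseteq> B t" and quarter: "4 * center_index (B t) \<le> center_index M"
    and witness: "\<exists>h. h \<in> carrier G \<and> h \<notin> M \<and> (\<forall>m\<in>B t. h \<otimes> m = m \<otimes> h)"
    if m0: "m0 \<in> E t" and t: "t \<in> T" for m0 t
  proof -
    have m0M: "m0 \<in> M" and tC: "t = C (g \<otimes> m0)" using m0 by (auto simp: E_def)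
    have m0c: "m0 \<in> carrier G" using m0M Mc by blast
    define h where "h = g \<otimes> m0"
    have h: "h \<in> carrier G" "h \<notin> M" "t = C h" using g m0c gmM m0M tC by (auto simp: h_def)
    have tc: "t \<subseteq> carrier G" using h by (auto simp: centralizer_def)
    have "B t = \<Inter> ({M, t} \<union> C ` t)" by (auto simp: B_def)
    moreover have "subgroup (\<Inter> ({M, t} \<union> C ` t)) G"
      by (rule subgroups_Inter) (use M h tc subgroup_centralizer in auto)
    ultimately have Bs: "subgroup (B t) G" by simp
    have "Z \<subseteq> M" using x center_subset_centralizer by (simp add: M_def)
    moreover have "Z \<subseteq> t" using h center_subset_centralizer by simp
    moreover have "Z \<subseteq> C y" if "y \<in> t" for y using that tc center_subset_centralizer by blast
    ultimately show Zs: "Z \<subseteq> B t" unfolding B_def by blast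
    have "h \<otimes> m = m \<otimes> h" if "m \<in> B t" for m
    proof -
      have "m \<in> C h" using that h(3) by (simp add: B_def)
      then show ?thesis by (simp add: centralizer_def)
    qed
    then show "\<exists>h. h \<in> carrier G \<and> h \<notin> M \<and> (\<forall>m\<in>B t. h \<otimes> m = m \<otimes> h)" using h by blast
    \<comment> \<open>\<open>g \<otimes> m\<close> lies in the center of its own centralizer
      \<open>t\<close>. The quotient of two such elements is \<open>inv m0 \<otimes> m\<close>,
      which therefore lies in \<open>B t\<close>; so \<open>E t\<close> is inside one coset of
      \<open>B t\<close>.\<close>
    have in_center: "g \<otimes> m \<in> t \<inter> (\<Inter>y\<in>t. C y)" if "m \<in> E t" for m
    proof -
      have "C (g \<otimes> m) = t" "m \<in> carrier G" using that Mc by (auto simp: E_def)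
      moreover from this have gm: "g \<otimes> m \<in> carrier G" using g by simp
      ultimately show ?thesis using self[OF gm] centralizer_sym[OF gm] by blast
    qed
    have St: "subgroup (t \<inter> (\<Inter>y\<in>t. C y)) G"
    proof -
      have "t \<inter> (\<Inter>y\<in>t. C y) = \<Inter> ({t} \<union> C ` t)" by auto
      moreover have "subgroup (\<Inter> ({t} \<union> C ` t)) G"
        by (rule subgroups_Inter) (use h tc subgroup_centralizer in auto)
      ultimately show ?thesis by simp
    qed
    have "E t \<subseteq> (\<otimes>) m0 ` B t"
    proof
      fix m assume m: "m \<in> E t"
      have mM: "m \<in> M" using m by (simp add: E_def)
      then have mc: "m \<in> carrier G" using Mc by blast
      have "inv (g \<otimes> m0) \<otimes> (g \<otimes> m) \<in> t \<inter> (\<Inter>y\<in>t. C y)"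
        using subgroup.m_closed[OF St subgroup.m_inv_closed[OF St in_center[OF m0]] in_center[OF m]] .
      moreover have "inv (g \<otimes> m0) \<otimes> (g \<otimes> m) = inv m0 \<otimes> m"
        using g m0c mc by (simp add: inv_mult_group m_assoc inv_mult_cancel)
      moreover have "inv m0 \<otimes> m \<in> M"
        by (rule subgroup.m_closed[OF M subgroup.m_inv_closed[OF M m0M] mM])
      ultimately have "inv m0 \<otimes> m \<in> B t" by (simp add: B_def)
      moreover have "m = m0 \<otimes> (inv m0 \<otimes> m)" using m0c mc by (simp add: inv_mult_cancel)
      ultimately show "m \<in> (\<otimes>) m0 ` B t" by blast
    qed
    moreover have Bc: "B t \<subseteq> carrier G" using Mc by (auto simp: B_def)
    ultimately have "center_index (E t) \<le> center_index ((\<otimes>) m0 ` B t)"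
      using m0c by (intro center_index_mono[OF fi]) auto
    then show "center_index (E t) \<le> center_index (B t)"
      using center_index_translate[OF fi m0c Bc] by simp
    have Bcomm: "u \<otimes> v = v \<otimes> u" if "u \<in> B t" "v \<in> B t" for u v
    proof -
      have "u \<in> C v" using that by (simp add: B_def)
      then show ?thesis by (simp add: centralizer_def)
    qed
    have xB: "x \<notin> B t" using t by (auto simp: B_def T_def)
    \<comment> \<open>Such an \<open>m\<close> puts \<open>1, x, m, x m\<close> into four different
      cosets of \<open>B t\<close>. Otherwise \<open>B t\<close> and its translates by
      \<open>x\<close> and \<open>inv x\<close> cover \<open>M\<close>. Then \<open>a\<close> and
      \<open>b\<close> are products of a power of \<open>x\<close>, which is central in
      \<open>M\<close>, and an element of the abelian group \<open>B t\<close>, so they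
      commute.\<close>
    have "\<exists>m\<in>M. m \<notin> B t \<and> inv x \<otimes> m \<notin> B t \<and> x \<otimes> m \<notin> B t"
    proof (rule ccontr)
      assume none: "\<not> ?thesis"
      have cov: "\<exists>w\<in>B t. \<exists>s. s \<in> carrier G \<and> C x \<subseteq> C s \<and> m = s \<otimes> w" if m: "m \<in> M" for m
      proof -
        have mc: "m \<in> carrier G" using m Mc by blast
        consider "m \<in> B t" | "inv x \<otimes> m \<in> B t" | "x \<otimes> m \<in> B t" using none m by blast
        then show ?thesis
        proof cases
          case 1 then show ?thesis using mc by (intro bexI[of _ m] exI[of _ \<one>]) (auto simp: centralizer_def)
        next
          case 2 then show ?thesis using mc x
            by (intro bexI[of _ "inv x \<otimes> m"] exI[of _ x]) (auto simp: inv_mult_cancel)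
        next
          case 3
          have "C x \<subseteq> C (inv x)"
            using x subgroup.m_inv_closed[OF subgroup_centralizer] centralizer_sym by (metis inv_closed subsetI centralizer_closed)
          then show ?thesis using 3 mc x
            by (intro bexI[of _ "x \<otimes> m"] exI[of _ "inv x"]) (auto simp: inv_mult_cancel)
        qed
      qed
      obtain w s where w: "w \<in> B t" "s \<in> carrier G" "C x \<subseteq> C s" "a = s \<otimes> w" using cov aM by blast
      obtain w' s' where w': "w' \<in> B t" "s' \<in> carrier G" "C x \<subseteq> C s'" "b = s' \<otimes> w'" using cov bM by blast
      have wM: "w \<in> M" "w' \<in> M" using w w' by (auto simp: B_def)
      have wc: "w \<in> carrier G" "w' \<in> carrier G" using wM Mc by auto
      have e: "b \<otimes> s = s \<otimes> b" "w \<otimes> s' = s' \<otimes> w"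
        using w w' wM bM by (auto simp: M_def centralizer_def)
      have "a \<otimes> b = s \<otimes> (w \<otimes> s') \<otimes> w'" using w w' wc by (simp add: m_assoc)
      also have "\<dots> = s \<otimes> s' \<otimes> (w \<otimes> w')" using w w' wc by (simp add: e m_assoc)
      also have "\<dots> = s \<otimes> s' \<otimes> (w' \<otimes> w)" using Bcomm w w' by simp
      also have "\<dots> = s \<otimes> b \<otimes> w" using w w' wc by (simp add: m_assoc)
      also have "\<dots> = b \<otimes> s \<otimes> w" by (simp only: e(1))
      also have "\<dots> = b \<otimes> a" using w(2,4) wc bc by (simp add: m_assoc)
      finally show False using ab by simp
    qed
    then obtain m where m: "m \<in> M" "m \<notin> B t" "inv x \<otimes> m \<notin> B t" "x \<otimes> m \<notin> B t" by blast
    have mc: "m \<in> carrier G" using m Mc by blast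
    have inB: "inv u \<in> B t \<longleftrightarrow> u \<in> B t" if "u \<in> carrier G" for u
      using that Bs by (metis inv_inv subgroup.m_inv_closed)
    have oneB: "\<one> \<in> B t" using Bs subgroup.one_closed by blast
    let ?L = "{\<one>, x, m, x \<otimes> m}"
    have sep: "inv u \<otimes> v \<notin> B t" if "u \<in> ?L" "v \<in> ?L" "u \<noteq> v" for u v
    proof -
      have xm: "x \<otimes> m = m \<otimes> x" using xcomm m by simp
      have p: "inv m \<otimes> x \<notin> B t"
        using inB[of "inv x \<otimes> m"] m mc x by (simp add: inv_mult_group)
      have q: "inv x \<otimes> (x \<otimes> m) \<notin> B t" using m mc x by (simp add: inv_mult_cancel)
      have q': "inv (x \<otimes> m) \<otimes> x \<notin> B t"
        using inB[of "inv x \<otimes> (x \<otimes> m)"] q mc x by (simp add: inv_mult_group)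
      have r: "inv m \<otimes> (x \<otimes> m) \<notin> B t" unfolding xm using xB mc x by (simp add: inv_mult_cancel)
      have r': "inv (x \<otimes> m) \<otimes> m \<notin> B t"
        using inB[of "inv m \<otimes> (x \<otimes> m)"] r mc x by (simp add: inv_mult_group)
      show ?thesis using that m mc x xB p q q' r r' inB by auto
    qed
    have "card ?L = 4"
    proof -
      have "\<one> \<noteq> x" "\<one> \<noteq> m" "\<one> \<noteq> x \<otimes> m" using xB m oneB by auto
      moreover have "x \<noteq> m" "x \<noteq> x \<otimes> m" "m \<noteq> x \<otimes> m"
        using m oneB x mc xB by (auto simp: l_inv)
      ultimately show ?thesis by simp
    qed
    moreover have "card ?L * center_index (B t) \<le> center_index M"
      by (rule card_mult_center_index_le[OF fi Bs Zs M])
        (use sep m xM M in \<open>auto simp: B_def subgroup.one_closed subgroup.m_closed\<close>)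
    ultimately show "4 * center_index (B t) \<le> center_index M" by simp
  qed
  have quarterE: "4 * center_index (E t) \<le> center_index M" if t: "t \<in> T" for t
  proof (cases "E t = {}")
    case True then show ?thesis by (simp add: center_index_def)
  next
    case False then show ?thesis using E_le quarter t by fastforce
  qed
  have "4 * center_index M \<le> (\<Sum>t\<in>T. 4 * center_index (E t))"
    using cMle by (simp add: sum_distrib_left[symmetric])
  also have "\<dots> \<le> card T * center_index M"
    using quarterE sum_bounded_above[of T "\<lambda>t. 4 * center_index (E t)" "center_index M"] by simp
  finally have "4 \<le> card T" using cMpos by simp
  \<comment> \<open>At least five centralizers in \<open>K\<close>, at least four in
    \<open>T\<close> and at most nine in all: both bounds are attained.\<close>
  then have T4: "card T = 4" and K5: "card K = 5" using KT cardK by auto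
  have KN: "K = N" using card_subset_eq[OF finK NK] cardN K5 by simp
  \<comment> \<open>For noncentral \<open>m\<close> in \<open>B t\<close>, both \<open>C m\<close>
    and \<open>C (m \<otimes> x)\<close> lie in \<open>K = N\<close> and turn out to be among
    \<open>C a\<close>, \<open>C b\<close>, \<open>C (a \<otimes> b)\<close>. As \<open>m\<close>
    and \<open>m \<otimes> x\<close> commute while no two of \<open>a, b, a b\<close> do, the two
    centralizers coincide. But the witness \<open>h\<close> commutes with \<open>m\<close> and not
    with \<open>m \<otimes> x\<close>.\<close>
  have BtZ: "B t \<subseteq> Z" if m0: "m0 \<in> E t" and t: "t \<in> T" for m0 t
  proof (rule ccontr)
    assume "\<not> B t \<subseteq> Z"
    then obtain m where m: "m \<in> B t" "m \<notin> Z" by blast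
    have mM: "m \<in> M" using m by (simp add: B_def)
    have mc: "m \<in> carrier G" using mM Mc by blast
    have mxM: "m \<otimes> x \<in> M" by (rule subgroup.m_closed[OF M mM xM])
    have mxc: "m \<otimes> x \<in> carrier G" using mc x by simp
    obtain h where h: "h \<in> carrier G" "h \<notin> M" "h \<otimes> m = m \<otimes> h" using witness[OF m0 t] m by blast
    have hm: "h \<in> C m" using h by (simp add: centralizer_def)
    have hmx: "h \<notin> C (m \<otimes> x)"
    proof
      assume "h \<in> C (m \<otimes> x)"
      then have "h \<otimes> m \<otimes> x = m \<otimes> x \<otimes> h" using h(1) mc x by (simp add: centralizer_def m_assoc)
      moreover have "h \<otimes> m \<otimes> x = m \<otimes> (h \<otimes> x)" using h(1) mc x by (simp add: h(3) m_assoc)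
      ultimately have "m \<otimes> (h \<otimes> x) = m \<otimes> (x \<otimes> h)" using h(1) mc x by (simp add: m_assoc)
      then have "h \<in> M" using h mc x by (simp add: M_def centralizer_def)
      then show False using h by simp
    qed
    have "C m \<in> N" "C (m \<otimes> x) \<in> N"
      using in_K[OF mM] in_K[OF mxM] unfolding KN by auto
    moreover have "C m \<noteq> carrier G" "C m \<noteq> M" using m mc centralizer_eq_carrier_iff hm h by auto
    moreover have "C (m \<otimes> x) \<noteq> carrier G" using hmx h by auto
    \<comment> \<open>Otherwise all of \<open>M\<close> commutes with \<open>m \<otimes> x\<close>
      and with \<open>x\<close>, hence with \<open>m\<close>. Then \<open>C m\<close> contains both
      \<open>a\<close> and \<open>b\<close>, which none of the three remaining members of
      \<open>N\<close> does.\<close>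
    moreover have "C (m \<otimes> x) \<noteq> M"
    proof
      assume eq: "C (m \<otimes> x) = M"
      have "y \<in> C m" if y: "y \<in> M" for y
      proof -
        have yc: "y \<in> carrier G" using y Mc by blast
        have "y \<otimes> (m \<otimes> x) = m \<otimes> (x \<otimes> y)" using y eq mc x by (auto simp: centralizer_def m_assoc)
        then have "y \<otimes> m \<otimes> x = m \<otimes> y \<otimes> x" using xcomm[OF y] yc mc x by (simp add: m_assoc)
        then show ?thesis using yc mc x by (simp add: centralizer_def)
      qed
      then have "a \<in> C m" "b \<in> C m" using aM bM by auto
      then show False using \<open>C m \<in> N\<close> \<open>C m \<noteq> carrier G\<close> \<open>C m \<noteq> M\<close> a_b a_ab by (auto simp: N_def)
    qed
    ultimately obtain p q where pq: "p \<in> {a, b, a \<otimes> b}" "q \<in> {a, b, a \<otimes> b}" "C m = C p" "C (m \<otimes> x) = C q"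
      by (auto simp: N_def)
    have pqc: "p \<in> carrier G" "q \<in> carrier G" using pq ac bc by auto
    have "m \<otimes> x \<in> C m" using mc x(1) by (simp add: centralizer_def m_assoc xcomm[OF mM, symmetric])
    then have "p \<in> C q" using pq pqc mxc centralizer_sym by metis
    then have "p = q" using pq a_b a_ab b_ab centralizer_sym ac bc m_closed by (metis empty_iff insert_iff)
    then show False using pq hm hmx by simp
  qed
  have E1: "center_index (E t) \<le> 1" if t: "t \<in> T" for t
  proof (cases "E t = {}")
    case True then show ?thesis by (simp add: center_index_def)
  next
    case False
    then obtain m0 where m0: "m0 \<in> E t" by blast
    have "center_index (E t) \<le> center_index Z"
      using E_le[OF m0 t] BtZ[OF m0 t] BZ[OF m0 t] by simp
    then show ?thesis by (simp add: center_index_group_center)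
  qed
  have "center_index M \<le> 4"
    using cMle sum_bounded_above[of T "\<lambda>t. center_index (E t)" 1] E1 T4 by simp
  moreover have "5 \<le> center_index M"
  proof -
    \<comment> \<open>\<open>C\<close> is constant on cosets of \<open>Z\<close> and separates all
      these pairs except possibly \<open>a\<close> and \<open>x \<otimes> a\<close>, whose quotients
      are \<open>x\<close> and \<open>inv x\<close>.\<close>
    let ?L = "{\<one>, x, a, x \<otimes> a, b}"
    have ZC: "C u = C v" if "inv u \<otimes> v \<in> Z" "u \<in> carrier G" "v \<in> carrier G" for u v
      using centralizer_mult_center[OF that(2,1)] that by (simp add: inv_mult_cancel)
    have nZ: "inv u \<otimes> v \<notin> Z \<and> inv v \<otimes> u \<notin> Z"
      if "C u \<noteq> C v" "u \<in> carrier G" "v \<in> carrier G" for u v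
      using that ZC by metis
    have xa: "x \<otimes> a = a \<otimes> x" using xcomm aM by simp
    have b_xa: "b \<notin> C (x \<otimes> a)"
    proof
      assume "b \<in> C (x \<otimes> a)"
      then have "b \<otimes> x \<otimes> a = x \<otimes> (a \<otimes> b)" using ac bc x by (simp add: centralizer_def m_assoc)
      then have "x \<otimes> (b \<otimes> a) = x \<otimes> (a \<otimes> b)" using xcomm[OF bM] ac bc x by (simp add: m_assoc)
      then show False using ab ac bc x by simp
    qed
    have C1: "C \<one> = carrier G" by (auto simp: centralizer_def)
    have xac: "x \<otimes> a \<in> carrier G" using x ac by simp
    have axa: "inv a \<otimes> (x \<otimes> a) = x" "inv (x \<otimes> a) \<otimes> a = inv x"
      using ac x unfolding xa by (simp_all add: inv_mult_cancel inv_mult_group m_assoc l_inv)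
    have invx: "inv x \<notin> Z" using x subgroup.m_inv_closed[OF subgroup_group_center] by (metis inv_inv)
    have n: "C (x \<otimes> a) \<noteq> carrier G" "C (x \<otimes> a) \<noteq> M" "C (x \<otimes> a) \<noteq> C b"
      using b_xa bM bc self[OF bc] by blast+
    have ne: "C \<one> \<noteq> C x" "C \<one> \<noteq> C a" "C \<one> \<noteq> C (x \<otimes> a)" "C \<one> \<noteq> C b"
      "C x \<noteq> C a" "C x \<noteq> C (x \<otimes> a)" "C x \<noteq> C b" "C a \<noteq> C b" "C (x \<otimes> a) \<noteq> C b"
      using MneG CaG CbG Cne(1) n unfolding C1 M_def[symmetric] by metis+
    have sep: "inv u \<otimes> v \<notin> Z" if "u \<in> ?L" "v \<in> ?L" "u \<noteq> v" for u v
      using that ne[THEN nZ] ac bc x xac axa invx by auto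
    have "card ?L = 5"
    proof -
      have "x \<otimes> a \<noteq> a" using axa x subgroup.one_closed[OF subgroup_group_center] ac by (metis l_inv)
      moreover have "\<one> \<noteq> x" "\<one> \<noteq> a" "\<one> \<noteq> x \<otimes> a" "\<one> \<noteq> b" "x \<noteq> a" "x \<noteq> x \<otimes> a" "x \<noteq> b"
        "a \<noteq> b" "x \<otimes> a \<noteq> b" using ne by metis+
      ultimately show ?thesis by auto
    qed
    moreover have "card ?L * center_index Z \<le> center_index M"
      by (rule card_mult_center_index_le[OF fi subgroup_group_center subset_refl M])
        (use sep x aM bM xM M center_subset_centralizer in
          \<open>auto simp: subgroup.one_closed subgroup.m_closed M_def\<close>)
    ultimately show ?thesis by (simp add: center_index_group_center)
  qed
  ultimately show False by simp
qed

section \<open>Commutators and the second center\<close>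

lemma eq_commutator_mult:
  assumes "x \<in> carrier G" "y \<in> carrier G"
  shows "x \<otimes> y = commutator G x y \<otimes> (y \<otimes> x)"
  using assms by (simp add: commutator_def m_assoc inv_mult_cancel)

lemma commutator_eqI:
  assumes "x \<in> carrier G" "y \<in> carrier G" "c \<in> carrier G" "x \<otimes> y = c \<otimes> (y \<otimes> x)"
  shows "commutator G x y = c"
proof -
  have "commutator G x y = c \<otimes> (y \<otimes> x) \<otimes> inv x \<otimes> inv y"
    using assms by (simp add: commutator_def)
  also have "\<dots> = c" using assms by (simp add: m_assoc inv_mult_cancel)
  finally show ?thesis .
qed

lemma lower_central_closed: "lower_central G i \<subseteq> carrier G"
proof (induction i)
  case (Suc i)
  then have "{commutator G x y | x y. x \<in> lower_central G i \<and> y \<in> carrier G} \<subseteq> carrier G"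
    by (auto simp: commutator_def)
  then show ?case using generate_incl by simp
qed simp

text \<open>Take the first term of the lower central series that lies in \<open>Z\<close>. It is not
  the whole group, and any noncentral element of the preceding term will do.\<close>

lemma ex_second_center:
  assumes "nilpotent_group G" "Z \<noteq> carrier G"
  shows "\<exists>x \<in> carrier G - Z. \<forall>y \<in> carrier G. commutator G x y \<in> Z"
proof -
  obtain c where "lower_central G c = {\<one>}" using assms(1) by (auto simp: nilpotent_group_def)
  then have c: "lower_central G c \<subseteq> Z" using subgroup.one_closed[OF subgroup_group_center] by simp
  define k where "k = (LEAST i. lower_central G i \<subseteq> Z)"
  have k: "lower_central G k \<subseteq> Z" unfolding k_def using c by (rule LeastI)
  have "k \<noteq> 0"
  proof
    assume "k = 0"
    then show False using k assms(2) group_center_closed by auto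
  qed
  then obtain i where i: "k = Suc i" using not0_implies_Suc by blast
  have "\<not> lower_central G i \<subseteq> Z" using not_less_Least[of i "\<lambda>i. lower_central G i \<subseteq> Z"] i unfolding k_def by auto
  then obtain x where x: "x \<in> lower_central G i" "x \<notin> Z" by blast
  have "commutator G x y \<in> Z" if "y \<in> carrier G" for y
  proof -
    have "commutator G x y \<in> lower_central G (Suc i)"
      using x that by (auto intro!: generate.incl)
    then show ?thesis using k i by auto
  qed
  then show ?thesis using x lower_central_closed by blast
qed

text \<open>Moving \<open>y\<close> past each factor \<open>x\<close> costs one copy of the central
  element \<open>commutator G x y\<close>.\<close>

lemma commutator_pow_left:
  assumes x: "x \<in> carrier G" and y: "y \<in> carrier G" and c: "commutator G x y \<in> Z"
  shows "commutator G (x [^] (n::nat)) y = commutator G x y [^] n"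
proof -
  let ?c = "commutator G x y"
  have cc: "?c \<in> carrier G" using c group_center_closed by blast
  have "x [^] n \<otimes> y = ?c [^] n \<otimes> (y \<otimes> x [^] n)"
  proof (induction n)
    case 0 then show ?case using x y by simp
  next
    case (Suc n)
    have "x [^] Suc n \<otimes> y = x [^] n \<otimes> (?c \<otimes> (y \<otimes> x))"
      using x y eq_commutator_mult[OF x y] by (simp add: m_assoc)
    also have "\<dots> = ?c \<otimes> (x [^] n \<otimes> y) \<otimes> x"
      using x y cc group_center_comm[OF c, of "x [^] n"] by (simp add: m_assoc[symmetric])
    also have "\<dots> = ?c \<otimes> ?c [^] n \<otimes> (y \<otimes> (x [^] n \<otimes> x))"
      using x y cc by (simp add: Suc m_assoc)
    also have "\<dots> = ?c [^] Suc n \<otimes> (y \<otimes> x [^] Suc n)"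
      using cc group_center_comm[OF c, of "?c [^] n"] by simp
    finally show ?case .
  qed
  then show ?thesis using x y cc by (intro commutator_eqI) auto
qed

text \<open>For \<open>x\<close> in the second center this makes \<open>commutator G x\<close> a
  homomorphism from \<open>G\<close> to \<open>Z\<close>.\<close>

lemma commutator_mult_right:
  assumes x: "x \<in> carrier G" and y: "y \<in> carrier G" and w: "w \<in> carrier G"
    and c: "commutator G x y \<in> Z" and d: "commutator G x w \<in> Z"
  shows "commutator G x (y \<otimes> w) = commutator G x y \<otimes> commutator G x w"
proof -
  let ?c = "commutator G x y" and ?d = "commutator G x w"
  have cc: "?c \<in> carrier G" "?d \<in> carrier G" using c d group_center_closed by blast+
  have "x \<otimes> (y \<otimes> w) = ?c \<otimes> (y \<otimes> x) \<otimes> w"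
    using x y w eq_commutator_mult[OF x y] by (simp add: m_assoc[symmetric])
  also have "\<dots> = ?c \<otimes> (y \<otimes> (x \<otimes> w))" using x y w cc by (simp add: m_assoc)
  also have "\<dots> = ?c \<otimes> (y \<otimes> (?d \<otimes> (w \<otimes> x)))" using eq_commutator_mult[OF x w] by simp
  also have "\<dots> = ?c \<otimes> (y \<otimes> ?d) \<otimes> (w \<otimes> x)" using x y w cc by (simp add: m_assoc)
  also have "\<dots> = ?c \<otimes> (?d \<otimes> y) \<otimes> (w \<otimes> x)" using group_center_comm[OF d y] by simp
  also have "\<dots> = ?c \<otimes> ?d \<otimes> (y \<otimes> w \<otimes> x)" using x y w cc by (simp add: m_assoc)
  finally show ?thesis using x y w cc by (intro commutator_eqI) auto
qed

lemma commutator_eq_one_iff: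
  assumes "x \<in> carrier G" "y \<in> carrier G"
  shows "commutator G x y = \<one> \<longleftrightarrow> x \<otimes> y = y \<otimes> x"
proof
  assume "commutator G x y = \<one>"
  then show "x \<otimes> y = y \<otimes> x" using eq_commutator_mult[OF assms] assms by simp
next
  assume "x \<otimes> y = y \<otimes> x"
  then show "commutator G x y = \<one>" using assms by (intro commutator_eqI) auto
qed

text \<open>By Bezout, \<open>x\<close> is a product of powers of \<open>x [^] k\<close> and
  \<open>x [^] l\<close>.\<close>

lemma mem_subgroup_if_coprime_pow:
  fixes k l :: int
  assumes S: "subgroup S G" and x: "x \<in> carrier G"
    and k: "x [^] k \<in> S" and l: "x [^] l \<in> S" and "coprime k l"
  shows "x \<in> S"
proof -
  obtain u v where uv: "u * k + v * l = 1"
    using bezout_int[of k l] \<open>coprime k l\<close> by auto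
  have "(x [^] k) [^] u \<in> S" "(x [^] l) [^] v \<in> S"
    using subgroup_int_pow_closed[OF S] k l by auto
  then have "(x [^] k) [^] u \<otimes> (x [^] l) [^] v \<in> S" by (rule subgroup.m_closed[OF S])
  moreover have "(x [^] k) [^] u \<otimes> (x [^] l) [^] v = x [^] (u * k + v * l)"
    using x by (simp add: int_pow_pow int_pow_mult mult.commute)
  ultimately show ?thesis using uv x by simp
qed

text \<open>By pigeonhole some positive power of a second-center element is central. If
  \<open>k\<close> is the least such exponent and the prime \<open>p\<close> divides it, the power
  with exponent \<open>k div p\<close> is still noncentral, and its commutators are powers of the
  old ones.\<close>

lemma ex_second_center_prime:
  assumes fin: "finite ((#>) Z ` carrier G)" and nil: "nilpotent_group G" and na: "Z \<noteq> carrier G"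
  shows "\<exists>x p. x \<in> carrier G \<and> x \<notin> Z \<and> (\<forall>y \<in> carrier G. commutator G x y \<in> Z)
    \<and> Factorial_Ring.prime p \<and> x [^] (p::nat) \<in> Z"
proof -
  obtain x where x: "x \<in> carrier G" "x \<notin> Z" and c: "\<And>y. y \<in> carrier G \<Longrightarrow> commutator G x y \<in> Z"
    using ex_second_center[OF nil na] by auto
  have "\<not> inj_on (\<lambda>i::nat. Z #> x [^] i) UNIV"
  proof
    assume "inj_on (\<lambda>i::nat. Z #> x [^] i) UNIV"
    moreover have "range (\<lambda>i::nat. Z #> x [^] i) \<subseteq> (#>) Z ` carrier G" using x by auto
    ultimately show False using fin by (meson finite_subset finite_imageD infinite_UNIV_nat)
  qed
  then obtain i j :: nat where ij: "i < j" "Z #> x [^] i = Z #> x [^] j"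
    unfolding inj_on_def by (metis linorder_neqE_nat UNIV_I)
  have "inv (x [^] i) \<otimes> x [^] j \<in> Z" using ij x rcos_center_eq_iff by simp
  moreover have "x [^] j = x [^] i \<otimes> x [^] (j - i)" using ij x by (simp add: nat_pow_mult)
  ultimately have "x [^] (j - i) \<in> Z" using x by (simp add: inv_mult_cancel)
  then have ex: "\<exists>k>0. x [^] (k::nat) \<in> Z" using ij by (intro exI[of _ "j - i"]) simp
  define k where "k = (LEAST k. k > 0 \<and> x [^] (k::nat) \<in> Z)"
  have k: "k > 0" "x [^] k \<in> Z" using LeastI_ex[OF ex] by (auto simp: k_def)
  have "k \<noteq> 1"
  proof
    assume "k = 1"
    then have "x [^] Suc 0 \<in> Z" using k by simp
    then show False using x by simp
  qed
  then obtain p where p: "Factorial_Ring.prime p" "p dvd k" using prime_factor_nat by blast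
  define l where "l = k div p"
  have kl: "k = l * p" using p by (simp add: l_def)
  have l: "0 < l" "l < k" using k(1) p kl prime_gt_1_nat[OF p(1)] by auto
  have "x [^] l \<notin> Z" using not_less_Least[of l "\<lambda>k. k > 0 \<and> x [^] (k::nat) \<in> Z"] l unfolding k_def by auto
  moreover have "(x [^] l) [^] p \<in> Z" using k kl x by (simp add: nat_pow_pow)
  moreover have "commutator G (x [^] l) y \<in> Z" if y: "y \<in> carrier G" for y
  proof -
    have "commutator G x y [^] int l \<in> Z"
      by (rule subgroup_int_pow_closed[OF subgroup_group_center c[OF y]])
    then show ?thesis using commutator_pow_left[OF x(1) y c[OF y]] by (simp add: int_pow_int)
  qed
  ultimately show ?thesis using p x by (intro exI[of _ "x [^] l"] exI[of _ p]) auto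
qed

text \<open>Lagrange in the image of \<open>S\<close> in \<open>G Mod Z\<close>: it has
  \<open>center_index S\<close> elements, and the coset of \<open>g\<close> has order
  \<open>p\<close> there.\<close>

lemma prime_dvd_center_index:
  assumes fin: "finite ((#>) Z ` carrier G)" and S: "subgroup S G" and g: "g \<in> S" "g \<notin> Z"
    and p: "Factorial_Ring.prime p" "g [^] (p::nat) \<in> Z"
  shows "p dvd center_index S"
proof -
  interpret N: normal Z G by (rule normal_group_center)
  interpret Q: group "G Mod Z" by (rule N.factorgroup_is_group)
  have hom: "(\<lambda>a. Z #> a) \<in> hom G (G Mod Z)" by (rule N.r_coset_hom_Mod)
  interpret h: group_hom G "G Mod Z" "\<lambda>a. Z #> a"
    by (simp add: group_hom_def group_hom_axioms_def hom is_group Q.is_group)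
  have Sc: "S \<subseteq> carrier G" using S subgroup.subset by blast
  have gc: "g \<in> carrier G" using g Sc by blast
  let ?T = "(#>) Z ` S"
  have T: "subgroup ?T (G Mod Z)" using h.subgroup_img_is_subgroup[OF S] .
  let ?K = "(G Mod Z)\<lparr>carrier := ?T\<rparr>"
  interpret K: group ?K using Q.subgroup_imp_group[OF T] .
  have "finite ?T" using Sc by (auto intro!: finite_subset[OF _ fin])
  moreover have gT: "Z #> g \<in> ?T" using g by blast
  ultimately have dvd: "K.ord (Z #> g) dvd order ?K" by (intro K.ord_dvd_group_order) auto
  have pow: "(Z #> g) [^]\<^bsub>?K\<^esub> n = Z #> g [^] n" for n :: nat
    using h.hom_nat_pow[OF gc, of n] by (simp add: Q.nat_pow_consistent[symmetric])
  have one: "\<one>\<^bsub>?K\<^esub> = Z" by (simp add: FactGroup_def)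
  have "(Z #> g) [^]\<^bsub>?K\<^esub> p = \<one>\<^bsub>?K\<^esub>"
    unfolding pow one using p group_center_closed subgroup_group_center by (simp add: coset_join2)
  then have "K.ord (Z #> g) dvd p" using gT K.pow_eq_id[of "Z #> g" p] by auto
  moreover have "K.ord (Z #> g) \<noteq> 1"
  proof
    assume "K.ord (Z #> g) = 1"
    then have "Z #> g = Z" using K.ord_eq_1[of "Z #> g"] gT one by auto
    then show False using g gc rcos_self[OF gc subgroup_group_center] by simp
  qed
  ultimately have "K.ord (Z #> g) = p" using p by (auto simp: prime_nat_iff)
  then show ?thesis using dvd by (simp add: order_def center_index_def)
qed

end

section \<open>Two generators modulo the center\<close>

text \<open>This data fixes the isoclinism class. Primality makes \<open>q\<close> the exact order
  of the commutator; that \<open>x\<close> and \<open>g\<close> have order \<open>q\<close> modulo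
  \<open>Z\<close> is then a consequence, so natural exponents reach every coset.\<close>

locale prime_two_generated = group G for G (structure) +
  fixes q :: nat and x g :: 'a
  assumes q: "Factorial_Ring.prime q"
    and xg: "x \<in> carrier G" "g \<in> carrier G"
    and cZ: "commutator G x g \<in> Z" and c_ne: "commutator G x g \<noteq> \<one>"
    and c_pow: "commutator G x g [^] q = \<one>"
    and gen: "\<And>h. h \<in> carrier G \<Longrightarrow> \<exists>(i::nat) (j::nat). \<exists>z\<in>Z. h = x [^] i \<otimes> g [^] j \<otimes> z"

context group
begin

text \<open>Abelian proper centralizers make commuting a transitive relation on noncentral elements:
  whatever commutes with \<open>u\<close> lies with \<open>v\<close> in the abelian group
  \<open>C u\<close>.\<close>

lemma centralizer_eq_iff_commute:
  assumes ab: "\<And>x a b. x \<in> carrier G \<Longrightarrow> x \<notin> Z \<Longrightarrow> a \<in> C x \<Longrightarrow> b \<in> C x \<Longrightarrow> a \<otimes> b = b \<otimes> a"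
    and u: "u \<in> carrier G" "u \<notin> Z" and v: "v \<in> carrier G" "v \<notin> Z"
  shows "C u = C v \<longleftrightarrow> u \<otimes> v = v \<otimes> u"
proof
  assume "C u = C v"
  then have "u \<in> C v" using u by (auto simp: centralizer_def)
  then show "u \<otimes> v = v \<otimes> u" by (simp add: centralizer_def)
next
  assume uv: "u \<otimes> v = v \<otimes> u"
  have sub: "C x \<subseteq> C y"
    if x: "x \<in> carrier G" "x \<notin> Z" and y: "y \<in> carrier G" and xy: "y \<in> C x" for x y
    using ab[OF x _ xy] by (auto simp: centralizer_iff)
  have "v \<in> C u" "u \<in> C v" using u v uv by (simp_all add: centralizer_def)
  then show "C u = C v" using sub u v by blast
qed

text \<open>This covers every prime \<open>q\<close>; the bound \<open>9\<close> serves to establish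
  \<open>ab\<close>. The summand \<open>2\<close> stands for the centralizers \<open>G\<close> and
  \<open>M\<close>.\<close>

lemma ex_prime_two_generated_if_abelian_centralizers:
  assumes fin: "finite (Cent G)"
    and ab: "\<And>x a b. x \<in> carrier G \<Longrightarrow> x \<notin> Z \<Longrightarrow> a \<in> C x \<Longrightarrow> b \<in> C x \<Longrightarrow> a \<otimes> b = b \<otimes> a"
    and q: "Factorial_Ring.prime q" "card (Cent G) = q + 2"
    and nil: "nilpotent_group G"
  shows "\<exists>x g. prime_two_generated G q x g"
proof -
  have fi: "finite ((#>) Z ` carrier G)" using finite_rcosets_center[OF fin] .
  have Zs: "subgroup Z G" by (rule subgroup_group_center)
  have "Z \<noteq> carrier G"
  proof
    assume "Z = carrier G"
    then have "Cent G \<subseteq> {carrier G}" using centralizer_eq_carrier_iff by (auto simp: Cent_def)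
    then have "card (Cent G) \<le> 1" using card_mono[of "{carrier G}"] by fastforce
    then show False using q by simp
  qed
  then obtain x p where x: "x \<in> carrier G" "x \<notin> Z" and xc: "\<And>y. y \<in> carrier G \<Longrightarrow> commutator G x y \<in> Z"
    and p: "Factorial_Ring.prime p" "x [^] (p::nat) \<in> Z"
    using ex_second_center_prime[OF fi nil] by blast
  define M where "M = C x"
  \<comment> \<open>\<open>k\<close> is a homomorphism to \<open>Z\<close> with kernel \<open>M\<close>.\<close>
  define k where "k y = commutator G x y" for y
  have kZ: "k y \<in> Z" if "y \<in> carrier G" for y using xc that by (simp add: k_def)
  have kc: "k y \<in> carrier G" if "y \<in> carrier G" for y using kZ[OF that] group_center_closed by blast
  have M: "subgroup M G" using x subgroup_centralizer by (simp add: M_def)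
  have Mc: "M \<subseteq> carrier G" using M subgroup.subset by blast
  have ZM: "Z \<subseteq> M" using x center_subset_centralizer by (simp add: M_def)
  have xM: "x \<in> M" using x by (simp add: M_def centralizer_def)
  have k1: "k y = \<one> \<longleftrightarrow> y \<in> M" if y: "y \<in> carrier G" for y
    using commutator_eq_one_iff[OF x(1) y] x y by (auto simp: k_def M_def centralizer_def)
  have kmult: "k (y \<otimes> w) = k y \<otimes> k w" if "y \<in> carrier G" "w \<in> carrier G" for y w
    using commutator_mult_right[OF x(1) that] xc that by (simp add: k_def)
  have kpow: "k (y [^] n) = k y [^] n" if y: "y \<in> carrier G" for y and n :: nat
  proof (induction n)
    case 0 then show ?case using k1[of \<one>] subgroup.one_closed[OF M] by simp
  next
    case (Suc n) then show ?case using kmult[of "y [^] n" y] y by simp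
  qed
  \<comment> \<open>\<open>k y [^] p\<close> is the commutator of \<open>y\<close> with the central
    element \<open>x [^] p\<close>.\<close>
  have kp: "k y [^] p = \<one>" if y: "y \<in> carrier G" for y
    using commutator_pow_left[OF x(1) y xc[OF y], of p] commutator_eq_one_iff[of "x [^] p" y]
      group_center_comm[OF p(2) y] x y by (simp add: k_def)
  have k_inv: "k (inv y) \<otimes> k y = \<one>" if y: "y \<in> carrier G" for y
    using kmult[of "inv y" y] k1[of \<one>] subgroup.one_closed[OF M] y by simp
  have xpowM: "x [^] (n::nat) \<in> M" for n
    using subgroup_int_pow_closed[OF M xM, of "int n"] by (simp add: int_pow_int)
  have self: "y \<in> C y" if "y \<in> carrier G" for y using that by (simp add: centralizer_def)
  have nM_Z: "h \<notin> Z" if "h \<notin> M" for h using that ZM by blast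
  \<comment> \<open>A noncentral \<open>m\<close> in the intersection would have both
    \<open>h\<close> and \<open>x\<close> in its abelian centralizer, putting \<open>h\<close> into
    \<open>M\<close>.\<close>
  have CM: "C h \<inter> M = Z" if h: "h \<in> carrier G" "h \<notin> M" for h
  proof
    show "Z \<subseteq> C h \<inter> M" using ZM center_subset_centralizer[OF h(1)] by blast
    show "C h \<inter> M \<subseteq> Z"
    proof
      fix m assume m: "m \<in> C h \<inter> M"
      show "m \<in> Z"
      proof (rule ccontr)
        assume mZ: "m \<notin> Z"
        have mc: "m \<in> carrier G" using m Mc by blast
        have "h \<in> C m" using m centralizer_sym[OF h(1)] by blast
        moreover have "x \<in> C m" using m centralizer_sym[OF x(1)] by (simp add: M_def)
        ultimately have "h \<otimes> x = x \<otimes> h" using ab[OF mc mZ] by blast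
        then show False using h by (simp add: M_def centralizer_def)
      qed
    qed
  qed
  have C_eq: "C u = C v \<longleftrightarrow> u \<otimes> v = v \<otimes> u"
    if "u \<in> carrier G" "u \<notin> Z" "v \<in> carrier G" "v \<notin> Z" for u v
    using centralizer_eq_iff_commute[OF ab that] .
  define T where "T = C ` (carrier G - M)"
  have CmM: "C m = M" if m: "m \<in> M" "m \<notin> Z" for m
  proof -
    have "m \<in> carrier G" using m Mc by blast
    moreover have "m \<otimes> x = x \<otimes> m" using m by (simp add: M_def centralizer_def)
    ultimately show ?thesis using C_eq[of m x] m x by (simp add: M_def)
  qed
  have MG: "M \<noteq> carrier G" using x centralizer_eq_carrier_iff by (simp add: M_def)
  have "Cent G = insert (carrier G) (insert M T)"
  proof
    show "Cent G \<subseteq> insert (carrier G) (insert M T)"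
    proof
      fix D assume "D \<in> Cent G"
      then obtain y where y: "y \<in> carrier G" "D = C y" by (auto simp: Cent_def)
      consider "y \<in> Z" | "y \<in> M" "y \<notin> Z" | "y \<notin> M" by blast
      then show "D \<in> insert (carrier G) (insert M T)"
        using y CmM centralizer_eq_carrier_iff by cases (auto simp: T_def)
    qed
    have "carrier G = C \<one>" by (auto simp: centralizer_def)
    then show "insert (carrier G) (insert M T) \<subseteq> Cent G"
      using x by (auto simp: Cent_def M_def T_def)
  qed
  moreover have xT: "x \<notin> t" if "t \<in> T" for t
    using that x centralizer_sym[OF _ , of _ x] by (auto simp: T_def M_def centralizer_def)
  then have "M \<notin> T" "carrier G \<notin> T" using xM x by blast+
  moreover have finT: "finite T" using calculation(1) fin by simp
  ultimately have cT: "card T = q" using q MG by auto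
  have pk: "coprime (int p) (int n)" if "0 < n" "n < p" for n
    using that p(1) prime_imp_coprime_nat[of p n] nat_dvd_not_less by (auto simp: coprime_int_iff)
  \<comment> \<open>Distinct members of \<open>T\<close> meet in \<open>Z\<close>, and so do members
    of \<open>T\<close> and \<open>M\<close>. Hence the index of \<open>G\<close> over
    \<open>Z\<close> is that of \<open>M\<close> plus the sum over \<open>t\<close> in
    \<open>T\<close> of the index of \<open>t\<close> minus one. All these indices are multiples of
    \<open>p\<close>.\<close>
  have Tp: "p dvd card T"
  proof -
    have Tsub: "subgroup t G" "Z \<subseteq> t" "t \<subseteq> carrier G" if "t \<in> T" for t
      using that subgroup_centralizer center_subset_centralizer by (auto simp: T_def centralizer_def)
    let ?W = "\<lambda>S. (#>) Z ` S"
    have sat: "v \<in> S" if S: "subgroup S G" "Z \<subseteq> S" "u \<in> S" and v: "v \<in> carrier G" "Z #> u = Z #> v" for S u v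
    proof -
      have u: "u \<in> carrier G" using S subgroup.mem_carrier by metis
      then have "inv u \<otimes> v \<in> S" using v S rcos_center_eq_iff by blast
      from subgroup.m_closed[OF S(1,3) this] show ?thesis using u v by (simp add: inv_mult_cancel)
    qed
    have WZ: "Z #> u = Z \<longleftrightarrow> u \<in> Z" if "u \<in> carrier G" for u
      using that Zs rcos_self coset_join2 by metis
    have tM: "t \<inter> M = Z" if "t \<in> T" for t using that CM by (auto simp: T_def)
    have tt: "t = t'" if t: "t \<in> T" "t' \<in> T" and v: "v \<in> t" "v \<in> t'" "v \<notin> Z" for t t' v
    proof -
      obtain h h' where h: "h \<in> carrier G" "h \<notin> M" "t = C h" "h' \<in> carrier G" "h' \<notin> M" "t' = C h'"
        using t by (auto simp: T_def)
      have "v \<in> carrier G" "v \<otimes> h = h \<otimes> v" "v \<otimes> h' = h' \<otimes> v" using v h by (auto simp: centralizer_def)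
      then show ?thesis using C_eq[of v h] C_eq[of v h'] h nM_Z v by auto
    qed
    have split: "?W (carrier G) = ?W M \<union> (\<Union>t\<in>T. ?W t - {Z})"
    proof
      show "?W (carrier G) \<subseteq> ?W M \<union> (\<Union>t\<in>T. ?W t - {Z})"
      proof
        fix w assume "w \<in> ?W (carrier G)"
        then obtain y where y: "y \<in> carrier G" "w = Z #> y" by blast
        show "w \<in> ?W M \<union> (\<Union>t\<in>T. ?W t - {Z})"
        proof (cases "y \<in> M")
          case False
          then have "C y \<in> T" "y \<in> C y" "w \<noteq> Z" using y self WZ nM_Z by (auto simp: T_def)
          then show ?thesis using y by blast
        qed (use y in blast)
      qed
      show "?W M \<union> (\<Union>t\<in>T. ?W t - {Z}) \<subseteq> ?W (carrier G)" using Mc Tsub(3) by blast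
    qed
    have disjM: "?W M \<inter> (\<Union>t\<in>T. ?W t - {Z}) = {}"
    proof (rule ccontr)
      assume "\<not> ?thesis"
      then obtain w t where "w \<in> ?W M" "t \<in> T" "w \<in> ?W t" "w \<noteq> Z" by blast
      then obtain m v where t: "t \<in> T" "m \<in> M" "v \<in> t" "Z #> m = Z #> v" "Z #> v \<noteq> Z" by auto
      have vc: "v \<in> carrier G" using Tsub(3) t by blast
      have "v \<in> M" using sat[OF M ZM t(2) vc t(4)] .
      then show False using tM[OF t(1)] t WZ[OF vc] by blast
    qed
    have disjT: "(?W t - {Z}) \<inter> (?W t' - {Z}) = {}" if t: "t \<in> T" "t' \<in> T" "t \<noteq> t'" for t t'
    proof (rule ccontr)
      assume "\<not> ?thesis"
      then obtain w where "w \<in> ?W t" "w \<in> ?W t'" "w \<noteq> Z" by blast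
      then obtain u v where u: "u \<in> t" "v \<in> t'" "Z #> u = Z #> v" "Z #> v \<noteq> Z" by auto
      have vc: "v \<in> carrier G" using Tsub(3) t u by blast
      have "v \<in> t" using sat[OF Tsub(1,2)[OF t(1)] u(1) vc u(3)] .
      then show False using tt[OF t(1,2) _ u(2)] t(3) u WZ[OF vc] by blast
    qed
    have finW: "finite (?W S)" if "S \<subseteq> carrier G" for S
      by (rule finite_subset[OF _ fi]) (use that in blast)
    have "center_index (carrier G) = center_index M + (\<Sum>t\<in>T. card (?W t - {Z}))"
      unfolding center_index_def split
      using card_Un_disjoint[OF finW[OF Mc] _ disjM] card_UN_disjoint[OF finT, of "\<lambda>t. ?W t - {Z}"]
        disjT finT finW Tsub(3) by auto
    also have "(\<Sum>t\<in>T. card (?W t - {Z})) = (\<Sum>t\<in>T. center_index t - 1)"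
    proof (rule sum.cong[OF refl])
      fix t assume t: "t \<in> T"
      have "\<one> \<in> t" using Tsub(2)[OF t] subgroup.one_closed[OF Zs] by blast
      then have "Z #> \<one> \<in> ?W t" by blast
      then have "Z \<in> ?W t" using WZ[of \<one>] subgroup.one_closed[OF Zs] by simp
      then show "card (?W t - {Z}) = center_index t - 1" by (simp add: center_index_def card_Diff_singleton)
    qed
    \<comment> \<open>Adding \<open>card T\<close> undoes the truncated subtraction, as each
      \<open>t\<close> has at least one coset of \<open>Z\<close>.\<close>
    finally have "center_index (carrier G) + card T = center_index M + (\<Sum>t\<in>T. center_index t - 1) + (\<Sum>t\<in>T. 1)"
      by simp
    also have "\<dots> = center_index M + (\<Sum>t\<in>T. center_index t - 1 + 1)" by (simp only: sum.distrib add.assoc)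
    also have "\<dots> = center_index M + (\<Sum>t\<in>T. center_index t)"
    proof -
      have "center_index t - 1 + 1 = center_index t" if "t \<in> T" for t
        using center_index_pos[OF fi Tsub(3)[OF that]] subgroup.one_closed[OF Tsub(1)[OF that]] by fastforce
      then show ?thesis by simp
    qed
    finally have eq: "center_index (carrier G) + card T = center_index M + (\<Sum>t\<in>T. center_index t)" .
    \<comment> \<open>\<open>h [^] p\<close> lies in the kernel \<open>M\<close> of \<open>k\<close>
      by \<open>kp\<close>, and also in \<open>C h\<close>; so it is central by
      \<open>CM\<close>.\<close>
    have "p dvd center_index t" if t: "t \<in> T" for t
    proof -
      obtain h where h: "h \<in> carrier G" "h \<notin> M" "t = C h" using t by (auto simp: T_def)
      have "h [^] p \<in> M" using k1[of "h [^] p"] kpow[of h p] kp[of h] h by simp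
      moreover have "h [^] p \<in> C h"
        using subgroup_int_pow_closed[OF subgroup_centralizer[OF h(1)] self[OF h(1)], of "int p"]
        by (simp add: int_pow_int)
      ultimately have "h [^] p \<in> Z" using CM[OF h(1,2)] by blast
      then show ?thesis using prime_dvd_center_index[OF fi Tsub(1)[OF t] _ nM_Z[OF h(2)] p(1)] self h by simp
    qed
    then have "p dvd (\<Sum>t\<in>T. center_index t)" by (rule dvd_sum)
    moreover have "p dvd center_index M" using prime_dvd_center_index[OF fi M xM x(2) p] .
    moreover have "p dvd center_index (carrier G)"
      using prime_dvd_center_index[OF fi subgroup_self x p] .
    ultimately show ?thesis using eq by (metis dvd_add dvd_add_right_iff)
  qed
  then have pq: "p = q" using cT p q by (auto simp: prime_nat_iff)
  have notM: "h \<otimes> m \<in> carrier G \<and> h \<otimes> m \<notin> M" if h: "h \<in> carrier G" "h \<notin> M" and m: "m \<in> M" for h m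
  proof -
    have mc: "m \<in> carrier G" using m Mc by blast
    have "k (h \<otimes> m) = k h" using kmult[OF h(1) mc] k1[OF mc] m kc[OF h(1)] by simp
    then show ?thesis using k1[OF h(1)] k1[of "h \<otimes> m"] h mc by simp
  qed
  \<comment> \<open>If \<open>h x^i\<close> and \<open>h x^j\<close> with \<open>i < j < p\<close>
    had equal centralizers, their quotient \<open>x [^] (j - i)\<close> would be central by
    \<open>CM\<close>. As \<open>x [^] p\<close> is central too, so would be \<open>x\<close>. Thus
    there are \<open>p\<close> different centralizers, and \<open>T\<close> has no more.\<close>
  have Teq: "T = (\<lambda>i. C (h \<otimes> x [^] i)) ` {..<p}" if h: "h \<in> carrier G" "h \<notin> M" for h
  proof (rule card_subset_eq[OF finT, symmetric])
    show "(\<lambda>i. C (h \<otimes> x [^] i)) ` {..<p} \<subseteq> T" using notM[OF h xpowM] by (auto simp: T_def)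
    have ne: "C (h \<otimes> x [^] i) \<noteq> C (h \<otimes> x [^] j)" if ij: "i < j" "j < p" for i j
    proof
      assume eq: "C (h \<otimes> x [^] i) = C (h \<otimes> x [^] j)"
      let ?u = "h \<otimes> x [^] i"
      have u: "?u \<in> carrier G" "?u \<notin> M" using notM[OF h xpowM] by auto
      have v: "h \<otimes> x [^] j \<in> C ?u" unfolding eq using h x self by simp
      have "inv ?u \<otimes> (h \<otimes> x [^] j) \<in> C ?u"
        using subgroup.m_closed[OF subgroup_centralizer[OF u(1)]
            subgroup.m_inv_closed[OF subgroup_centralizer[OF u(1)] self[OF u(1)]] v] .
      moreover have "x [^] j = x [^] i \<otimes> x [^] (j - i)" using ij x by (simp add: nat_pow_mult)
      then have "inv ?u \<otimes> (h \<otimes> x [^] j) = x [^] (j - i)"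
        using h x by (simp add: inv_mult_group m_assoc inv_mult_cancel)
      ultimately have "x [^] (j - i) \<in> Z" using CM[OF u] xpowM by auto
      then have "x \<in> Z"
        using mem_subgroup_if_coprime_pow[OF Zs x(1), of "int p" "int (j - i)"] p pk[of "j - i"] ij
        by (simp add: int_pow_int del: of_nat_diff)
      then show False using x by simp
    qed
    have "inj_on (\<lambda>i. C (h \<otimes> x [^] i)) {..<p}"
      using ne by (intro linorder_inj_onI') auto
    then show "card ((\<lambda>i. C (h \<otimes> x [^] i)) ` {..<p}) = card T" by (simp add: card_image cT pq)
  qed
  obtain g where g: "g \<in> carrier G" "g \<notin> M" using MG Mc by blast
  have meet: "\<exists>i. (h \<otimes> x [^] i) \<otimes> y = y \<otimes> (h \<otimes> x [^] (i::nat))"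
    if h: "h \<in> carrier G" "h \<notin> M" and y: "y \<in> carrier G" "y \<notin> M" for h y
  proof -
    have "C y \<in> T" using y by (simp add: T_def)
    then obtain i :: nat where i: "C y = C (h \<otimes> x [^] i)" using Teq[OF h] by auto
    have "h \<otimes> x [^] i \<in> carrier G" "h \<otimes> x [^] i \<notin> Z" using notM[OF h xpowM] nM_Z by auto
    then have "(h \<otimes> x [^] i) \<otimes> y = y \<otimes> (h \<otimes> x [^] i)"
      using C_eq[of y "h \<otimes> x [^] i"] i y(1) nM_Z[OF y(2)] by simp
    then show ?thesis by blast
  qed
  \<comment> \<open>By \<open>meet\<close>, some \<open>g x^i\<close> commutes with
    \<open>g m\<close>. Their quotient \<open>inv (x [^] i) \<otimes> m\<close> lies in
    \<open>M\<close> and in the centralizer of \<open>g x^i\<close>, so \<open>CM\<close> makes it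
    central.\<close>
  have MxZ: "\<exists>i. \<exists>z\<in>Z. m = x [^] (i::nat) \<otimes> z" if m: "m \<in> M" for m
  proof -
    have mc: "m \<in> carrier G" using m Mc by blast
    have gm: "g \<otimes> m \<in> carrier G" "g \<otimes> m \<notin> M" using notM[OF g m] by auto
    obtain i :: nat where i: "(g \<otimes> x [^] i) \<otimes> (g \<otimes> m) = (g \<otimes> m) \<otimes> (g \<otimes> x [^] i)"
      using meet[OF g gm] by blast
    let ?u = "g \<otimes> x [^] i"
    have u: "?u \<in> carrier G" "?u \<notin> M" using notM[OF g xpowM] by auto
    have v: "g \<otimes> m \<in> C ?u" using gm i by (simp add: centralizer_def)
    have "inv ?u \<otimes> (g \<otimes> m) \<in> C ?u"
      using subgroup.m_closed[OF subgroup_centralizer[OF u(1)]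
          subgroup.m_inv_closed[OF subgroup_centralizer[OF u(1)] self[OF u(1)]] v] .
    moreover have e: "inv ?u \<otimes> (g \<otimes> m) = inv (x [^] i) \<otimes> m"
      using g x mc by (simp add: inv_mult_group m_assoc inv_mult_cancel)
    moreover have "inv (x [^] i) \<otimes> m \<in> M"
      by (rule subgroup.m_closed[OF M subgroup.m_inv_closed[OF M xpowM] m])
    ultimately have "inv (x [^] i) \<otimes> m \<in> Z" using CM[OF u] by auto
    moreover have "m = x [^] i \<otimes> (inv (x [^] i) \<otimes> m)" using x mc by (simp add: inv_mult_cancel)
    ultimately show ?thesis by blast
  qed
  \<comment> \<open>Some \<open>y' \<in> y\<langle>x\<rangle>\<close> commutes with \<open>h\<close>, and \<open>h x\<close> commutes with some \<open>y' x\<^sup>j\<close>; expanding the latter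
    relation gives \<open>k(y) = k(h)\<^sup>j\<close>.\<close>
  have kgen: "\<exists>j. k y = k h [^] (j::nat)"
    if y: "y \<in> carrier G" "y \<notin> M" and h: "h \<in> carrier G" "h \<notin> M" for y h
  proof -
    obtain i :: nat where i: "(y \<otimes> x [^] i) \<otimes> h = h \<otimes> (y \<otimes> x [^] i)" using meet[OF y h] by blast
    define y' where "y' = y \<otimes> x [^] i"
    have y': "y' \<in> carrier G" "y' \<notin> M" using notM[OF y xpowM] by (auto simp: y'_def)
    have ky: "k y' = k y"
      using kmult[of y "x [^] i"] k1[of "x [^] i"] xpowM y x kc[OF y(1)] by (simp add: y'_def)
    have hx: "h \<otimes> x \<in> carrier G" "h \<otimes> x \<notin> M" using notM[OF h xM] by auto
    obtain j :: nat where j: "(y' \<otimes> x [^] j) \<otimes> (h \<otimes> x) = (h \<otimes> x) \<otimes> (y' \<otimes> x [^] j)"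
      using meet[OF y' hx] by blast
    have hy: "y' \<otimes> h = h \<otimes> y'" using i by (simp add: y'_def)
    have kh: "k h [^] j \<in> Z"
      using subgroup_int_pow_closed[OF Zs kZ[OF h(1)], of "int j"] by (simp add: int_pow_int)
    have xjh: "x [^] j \<otimes> h = k h [^] j \<otimes> (h \<otimes> x [^] j)"
      using eq_commutator_mult[of "x [^] j" h] commutator_pow_left[OF x(1) h(1) xc[OF h(1)], of j] x h
      by (simp add: k_def)
    have khc: "k h [^] j \<in> carrier G" using kh group_center_closed by blast
    have kyc: "k y' \<in> carrier G" "k y' \<in> Z" using kc kZ y' by auto
    let ?w = "h \<otimes> y' \<otimes> (x [^] j \<otimes> x)"
    have "(y' \<otimes> x [^] j) \<otimes> (h \<otimes> x) = y' \<otimes> (x [^] j \<otimes> h) \<otimes> x"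
      using y' x h by (simp add: m_assoc)
    also have "\<dots> = (y' \<otimes> k h [^] j) \<otimes> h \<otimes> x [^] j \<otimes> x"
      using y' x(1) h(1) khc unfolding xjh by (simp add: m_assoc)
    also have "\<dots> = k h [^] j \<otimes> (y' \<otimes> h) \<otimes> x [^] j \<otimes> x"
      unfolding group_center_comm[OF kh y'(1), symmetric] using y'(1) x(1) h(1) khc by (simp add: m_assoc)
    also have "\<dots> = k h [^] j \<otimes> ?w"
      unfolding hy using y'(1) x(1) h(1) khc by (simp add: m_assoc)
    finally have l: "(y' \<otimes> x [^] j) \<otimes> (h \<otimes> x) = k h [^] j \<otimes> ?w" .
    have xj: "x \<otimes> x [^] j = x [^] j \<otimes> x" using x by (metis nat_pow_Suc nat_pow_Suc2)
    have "(h \<otimes> x) \<otimes> (y' \<otimes> x [^] j) = h \<otimes> (x \<otimes> y') \<otimes> x [^] j"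
      using y' x h by (simp add: m_assoc)
    also have "\<dots> = (h \<otimes> k y') \<otimes> y' \<otimes> (x \<otimes> x [^] j)"
      using eq_commutator_mult[OF x(1) y'(1)] y'(1) x(1) h(1) kyc by (simp add: k_def m_assoc)
    also have "\<dots> = k y' \<otimes> ?w"
      unfolding group_center_comm[OF kyc(2) h(1), symmetric] xj
      using y'(1) x(1) h(1) kyc by (simp add: m_assoc)
    finally have "k h [^] j \<otimes> ?w = k y' \<otimes> ?w" using j l by simp
    then have "k h [^] j = k y'" using y'(1) x(1) h(1) kyc khc r_cancel by (metis m_closed nat_pow_closed)
    then show ?thesis using ky by (intro exI[of _ j]) simp
  qed
  have "\<exists>(i::nat) (j::nat). \<exists>z \<in> Z. h = x [^] i \<otimes> g [^] j \<otimes> z" if h: "h \<in> carrier G" for h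
  proof -
    have "\<exists>j. k h = k g [^] (j::nat)"
    proof (cases "h \<in> M")
      case True
      then show ?thesis using k1[OF h] by (intro exI[of _ 0]) simp
    next
      case False
      then show ?thesis using kgen[OF h False g] by blast
    qed
    then obtain j :: nat where j: "k h = k (g [^] j)" using kpow[OF g(1)] by auto
    \<comment> \<open>\<open>h\<close> and \<open>g [^] j\<close> have equal values under
      \<open>k\<close>, so this quotient lies in the kernel \<open>M\<close>, which
      \<open>MxZ\<close> describes.\<close>
    define m where "m = h \<otimes> inv (g [^] j)"
    have gj: "g [^] j \<in> carrier G" using g by simp
    have mc: "m \<in> carrier G" using h gj by (simp add: m_def)
    have "k m = k (inv (g [^] j)) \<otimes> k (g [^] j)"
      using kmult[OF h, of "inv (g [^] j)"] gj j group_center_comm[OF kZ[OF gj] kc[of "inv (g [^] j)"]]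
      by (simp add: m_def)
    then have "m \<in> M" using k_inv[OF gj] k1[OF mc] by simp
    then obtain i :: nat and z where z: "z \<in> Z" "m = x [^] i \<otimes> z" using MxZ by blast
    have zc: "z \<in> carrier G" using z group_center_closed by blast
    have "h = m \<otimes> g [^] j" using h gj by (simp add: m_def m_assoc)
    also have "\<dots> = x [^] i \<otimes> (z \<otimes> g [^] j)" using z zc gj x by (simp add: m_assoc)
    also have "\<dots> = x [^] i \<otimes> g [^] j \<otimes> z"
      unfolding group_center_comm[OF z(1) gj] using zc gj x by (simp add: m_assoc)
    finally show ?thesis using z by blast
  qed
  then have "prime_two_generated G q x g"
    using q(1) x(1) g(1) kZ[OF g(1)] k1[OF g(1)] kp[OF g(1)] g(2) unfolding k_def pq
    by unfold_locales simp_all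
  then show ?thesis by blast
qed

end

section \<open>Coordinates modulo the center\<close>

lemma (in group) commutator_pow_right:
  assumes x: "x \<in> carrier G" and y: "y \<in> carrier G" and c: "commutator G x y \<in> Z"
  shows "commutator G x (y [^] (n::nat)) = commutator G x y [^] n"
proof (induction n)
  case 0
  show ?case using x commutator_eq_one_iff[of x \<one>] by simp
next
  case (Suc n)
  have "commutator G x y [^] int n \<in> Z" by (rule subgroup_int_pow_closed[OF subgroup_group_center c])
  then have "commutator G x (y [^] n) \<in> Z" by (simp add: Suc int_pow_int)
  then show ?case using commutator_mult_right[OF x _ y _ c, of "y [^] n"] y Suc by simp
qed

context prime_two_generated
begin

definition c where "c = commutator G x g"

text \<open>A relation, since the exponents are determined only modulo \<open>q\<close>.\<close>

definition coord :: "'a \<Rightarrow> nat \<Rightarrow> nat \<Rightarrow> bool" where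
  "coord h i j \<longleftrightarrow> (\<exists>z\<in>Z. h = x [^] i \<otimes> g [^] j \<otimes> z)"

lemma c_center: "c \<in> Z" and c_closed: "c \<in> carrier G"
  using cZ group_center_closed by (auto simp: c_def)

lemma c_int_pow_center: "c [^] (m::int) \<in> Z"
  by (rule subgroup_int_pow_closed[OF subgroup_group_center c_center])

lemma c_int_pow_eq_iff: "c [^] (m::int) = c [^] (n::int) \<longleftrightarrow> [m = n] (mod int q)"
proof -
  have "ord c dvd q" using c_pow c_closed pow_eq_id[of c q] by (simp add: c_def)
  moreover have "ord c \<noteq> 1" using c_ne c_closed ord_eq_1 by (simp add: c_def)
  ultimately have "ord c = q" using q by (auto simp: prime_nat_iff)
  then show ?thesis using int_pow_eq[OF c_closed, of m n] by (simp add: cong_iff_dvd_diff dvd_diff_commute)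
qed

lemma coord_closed: "coord h i j \<Longrightarrow> h \<in> carrier G"
  using xg group_center_closed by (auto simp: coord_def)

lemma ex_coord: "h \<in> carrier G \<Longrightarrow> \<exists>i j. coord h i j"
  using gen by (simp add: coord_def)

lemma coord_pow: "coord (x [^] i \<otimes> g [^] j) i j"
  using xg subgroup.one_closed[OF subgroup_group_center] by (auto simp: coord_def intro!: bexI[of _ \<one>])

text \<open>Collecting moves \<open>x [^] k\<close> to the left past \<open>g [^] j\<close>, which
  costs the inverse of their commutator \<open>c [^] (j * k)\<close>.\<close>

lemma pow_mult_pow:
  "(x [^] (i::nat) \<otimes> g [^] (j::nat)) \<otimes> (x [^] (k::nat) \<otimes> g [^] (l::nat))
    = c [^] (- int (j * k)) \<otimes> (x [^] (i + k) \<otimes> g [^] (j + l))"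
proof -
  let ?d = "c [^] (- int (j * k))"
  have d: "?d \<in> Z" "?d \<in> carrier G" using c_int_pow_center c_closed by auto
  have cl: "x [^] n \<in> carrier G" "g [^] n \<in> carrier G" for n :: nat using xg by auto
  have xkg: "commutator G (x [^] k) g = c [^] k"
    using commutator_pow_left[OF xg cZ] by (simp add: c_def)
  have "c [^] k \<in> Z" using c_int_pow_center[of "int k"] by (simp add: int_pow_int)
  then have "commutator G (x [^] k) (g [^] j) = (c [^] k) [^] j"
    using commutator_pow_right[OF cl(1) xg(2), of k j] xkg by simp
  then have "commutator G (x [^] k) (g [^] j) = c [^] int (j * k)"
    using c_closed by (simp only: nat_pow_pow int_pow_int mult.commute)
  then have "x [^] k \<otimes> g [^] j = c [^] int (j * k) \<otimes> (g [^] j \<otimes> x [^] k)"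
    using eq_commutator_mult[OF cl(1) cl(2)] by metis
  then have "?d \<otimes> (x [^] k \<otimes> g [^] j) = (?d \<otimes> c [^] int (j * k)) \<otimes> (g [^] j \<otimes> x [^] k)"
    using d c_closed cl by (simp add: m_assoc)
  moreover have "?d \<otimes> c [^] int (j * k) = \<one>"
    using c_closed by (simp add: int_pow_mult[symmetric])
  ultimately have gx: "g [^] j \<otimes> x [^] k = ?d \<otimes> (x [^] k \<otimes> g [^] j)" using cl by simp
  have "(x [^] i \<otimes> g [^] j) \<otimes> (x [^] k \<otimes> g [^] l) = x [^] i \<otimes> (g [^] j \<otimes> x [^] k) \<otimes> g [^] l"
    using cl by (simp add: m_assoc)
  also have "\<dots> = (x [^] i \<otimes> ?d) \<otimes> (x [^] k \<otimes> g [^] j) \<otimes> g [^] l"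
    unfolding gx using cl d by (simp add: m_assoc)
  also have "\<dots> = ?d \<otimes> ((x [^] i \<otimes> x [^] k) \<otimes> (g [^] j \<otimes> g [^] l))"
    unfolding group_center_comm[OF d(1) cl(1), symmetric] using cl d by (simp add: m_assoc)
  also have "\<dots> = ?d \<otimes> (x [^] (i + k) \<otimes> g [^] (j + l))"
    using xg by (simp add: nat_pow_mult)
  finally show ?thesis .
qed

lemma mult_center_mult:
  assumes "a \<in> carrier G" "b \<in> carrier G" "z \<in> Z" "w \<in> Z"
  shows "(a \<otimes> z) \<otimes> (b \<otimes> w) = (a \<otimes> b) \<otimes> (z \<otimes> w)"
proof -
  have c: "z \<in> carrier G" "w \<in> carrier G" using assms group_center_closed by blast+
  have "(a \<otimes> z) \<otimes> (b \<otimes> w) = a \<otimes> (z \<otimes> b) \<otimes> w" using assms c by (simp add: m_assoc)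
  also have "\<dots> = (a \<otimes> b) \<otimes> (z \<otimes> w)"
    unfolding group_center_comm[OF assms(3,2)] using assms c by (simp add: m_assoc)
  finally show ?thesis .
qed

lemma coord_mult:
  assumes "coord h i j" "coord h' k l"
  shows "coord (h \<otimes> h') (i + k) (j + l)"
proof -
  obtain z z' where z: "z \<in> Z" "h = x [^] i \<otimes> g [^] j \<otimes> z" and z': "z' \<in> Z" "h' = x [^] k \<otimes> g [^] l \<otimes> z'"
    using assms by (auto simp: coord_def)
  let ?d = "c [^] (- int (j * k))" and ?P = "x [^] (i + k) \<otimes> g [^] (j + l)"
  have d: "?d \<in> Z" "?d \<in> carrier G" using c_int_pow_center c_closed by auto
  have zz: "z \<otimes> z' \<in> Z" by (rule subgroup.m_closed[OF subgroup_group_center z(1) z'(1)])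
  then have zzc: "z \<otimes> z' \<in> carrier G" using group_center_closed by blast
  have P: "?P \<in> carrier G" using xg by simp
  have "h \<otimes> h' = (?d \<otimes> ?P) \<otimes> (z \<otimes> z')"
    using mult_center_mult[OF _ _ z(1) z'(1)] pow_mult_pow[of i j k l] z z' xg by simp
  also have "\<dots> = ?P \<otimes> (?d \<otimes> (z \<otimes> z'))"
    unfolding group_center_comm[OF d(1) P] using d P zzc by (simp add: m_assoc)
  finally show ?thesis
    using subgroup.m_closed[OF subgroup_group_center d(1) zz] by (auto simp: coord_def)
qed

text \<open>The exponent is the determinant of the two coordinate vectors. The products in either
  order share \<open>?P\<close> and the central part \<open>z \<otimes> z'\<close>, and differ only
  in the power of \<open>c\<close> from \<open>pow_mult_pow\<close>.\<close>

lemma commutator_coord: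
  assumes "coord h i j" "coord h' k l"
  shows "commutator G h h' = c [^] (int i * int l - int j * int k)"
proof -
  obtain z z' where z: "z \<in> Z" "h = x [^] i \<otimes> g [^] j \<otimes> z" and z': "z' \<in> Z" "h' = x [^] k \<otimes> g [^] l \<otimes> z'"
    using assms by (auto simp: coord_def)
  let ?P = "x [^] (i + k) \<otimes> g [^] (j + l)"
  let ?m = "int i * int l - int j * int k"
  have zc: "z \<otimes> z' \<in> carrier G" using z z' group_center_closed by simp
  have P: "?P \<in> carrier G" using xg by simp
  have "h \<otimes> h' = c [^] (- int (j * k)) \<otimes> ?P \<otimes> (z \<otimes> z')"
    using mult_center_mult[OF _ _ z(1) z'(1)] pow_mult_pow[of i j k l] z z' xg by simp
  moreover have "h' \<otimes> h = c [^] (- int (l * i)) \<otimes> ?P \<otimes> (z \<otimes> z')"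
    using mult_center_mult[OF _ _ z'(1) z(1)] pow_mult_pow[of k l i j] z(2) z'(2) xg
      group_center_comm[OF z'(1) group_center_closed[OF z(1)]] by (simp add: add.commute)
  moreover have "c [^] (- int (j * k)) = c [^] ?m \<otimes> c [^] (- int (l * i))"
    using c_closed by (simp add: int_pow_mult[symmetric])
  ultimately have "h \<otimes> h' = c [^] ?m \<otimes> (h' \<otimes> h)"
    using c_closed P zc by (simp add: m_assoc)
  then show ?thesis
    using coord_closed[OF assms(1)] coord_closed[OF assms(2)] c_closed by (intro commutator_eqI) auto
qed

text \<open>Commutators with \<open>x\<close> and \<open>g\<close> recover the exponents
  \<open>j\<close> and \<open>i\<close> modulo \<open>q\<close>. Conversely, congruent exponents
  give equal commutators with every \<open>y\<close>, which makes \<open>inv h \<otimes> h'\<close>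
  central.\<close>

lemma rcos_center_eq_iff_coord:
  assumes h: "coord h i j" and h': "coord h' k l"
  shows "Z #> h = Z #> h' \<longleftrightarrow> [i = k] (mod q) \<and> [j = l] (mod q)"
proof
  note hc = coord_closed[OF h] coord_closed[OF h']
  have cx: "coord x 1 0" and cg: "coord g 0 1" using coord_pow[of 1 0] coord_pow[of 0 1] xg by simp_all
  assume "Z #> h = Z #> h'"
  then have w: "inv h \<otimes> h' \<in> Z" using rcos_center_eq_iff hc by simp
  obtain z where z: "z \<in> Z" "h = x [^] i \<otimes> g [^] j \<otimes> z" using h by (auto simp: coord_def)
  have zc: "z \<in> carrier G" using z group_center_closed by blast
  have "h' = h \<otimes> (inv h \<otimes> h')" using hc by (simp add: inv_mult_cancel)
  also have "\<dots> = x [^] i \<otimes> g [^] j \<otimes> (z \<otimes> (inv h \<otimes> h'))"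
    using zc xg group_center_closed[OF w] by (subst z(2)) (simp only: m_assoc nat_pow_closed m_closed)
  finally have h2: "coord h' i j"
    using subgroup.m_closed[OF subgroup_group_center z(1) w] by (auto simp: coord_def)
  have "c [^] int j = c [^] int l"
    using commutator_coord[OF cx h2] commutator_coord[OF cx h'] by simp
  moreover have "c [^] int i = c [^] int k"
    using commutator_coord[OF h2 cg] commutator_coord[OF h' cg] by simp
  ultimately show "[i = k] (mod q) \<and> [j = l] (mod q)"
    by (simp only: c_int_pow_eq_iff cong_int_iff)
next
  note hc = coord_closed[OF h] coord_closed[OF h']
  assume "[i = k] (mod q) \<and> [j = l] (mod q)"
  then have ij: "[int i = int k] (mod int q)" "[int j = int l] (mod int q)" by (simp_all add: cong_int_iff)
  have "(inv h \<otimes> h') \<otimes> y = y \<otimes> (inv h \<otimes> h')" if y: "y \<in> carrier G" for y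
  proof -
    obtain m n where mn: "coord y m n" using ex_coord y by blast
    have "[int i * int n - int j * int m = int k * int n - int l * int m] (mod int q)"
      using ij by (intro cong_diff cong_mult cong_refl)
    then have "commutator G h y = commutator G h' y"
      using commutator_coord[OF h mn] commutator_coord[OF h' mn] c_int_pow_eq_iff by simp
    then have "h \<otimes> y \<otimes> inv h = h' \<otimes> y \<otimes> inv h'"
      using hc y by (simp add: commutator_def)
    then have "inv h \<otimes> (h \<otimes> y \<otimes> inv h) \<otimes> h' = inv h \<otimes> (h' \<otimes> y \<otimes> inv h') \<otimes> h'" by simp
    then show ?thesis using hc y by (simp add: m_assoc inv_mult_cancel)
  qed
  then have "inv h \<otimes> h' \<in> Z" using hc by (simp add: group_center_iff)
  then show "Z #> h = Z #> h'" using rcos_center_eq_iff hc by simp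
qed

lemma derived_eq: "derived G (carrier G) = range (\<lambda>m::int. c [^] m)"
proof
  have c_gen: "range (\<lambda>m::int. c [^] m) = generate G {c}"
    using generate_pow[OF c_closed] by auto
  have "derived_set G (carrier G) \<subseteq> range (\<lambda>m::int. c [^] m)"
  proof
    fix y assume "y \<in> derived_set G (carrier G)"
    then obtain a b where ab: "a \<in> carrier G" "b \<in> carrier G" "y = commutator G a b"
      by (auto simp: commutator_def)
    obtain i j k l where "coord a i j" "coord b k l" using ex_coord ab by blast
    then show "y \<in> range (\<lambda>m::int. c [^] m)" using commutator_coord ab by blast
  qed
  moreover have "subgroup (range (\<lambda>m::int. c [^] m)) G"
    unfolding c_gen by (rule generate_is_subgroup) (use c_closed in auto)
  ultimately show "derived G (carrier G) \<subseteq> range (\<lambda>m::int. c [^] m)"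
    unfolding derived_def by (rule generate_subgroup_incl)
  have "subgroup (derived G (carrier G)) G" by (rule derived_is_subgroup) simp
  moreover have "c \<in> derived G (carrier G)"
    unfolding derived_def c_def commutator_def by (rule generate.incl) (use xg in auto)
  ultimately show "range (\<lambda>m::int. c [^] m) \<subseteq> derived G (carrier G)"
    using subgroup_int_pow_closed by auto
qed

end

section \<open>The isoclinism\<close>

text \<open>Both isomorphisms keep exponents: elements with the same coordinates correspond modulo
  the centers, and powers of the two commutators \<open>c\<close> correspond. They are compatible
  because commutators are given by the same determinant on both sides.\<close>

lemma isoclinic_if_prime_two_generated:
  assumes "prime_two_generated G q x g" and "prime_two_generated H q y h"
  shows "isoclinic G H"
proof -
  interpret A: prime_two_generated G q x g by fact
  interpret B: prime_two_generated H q y h by fact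
  let ?Z = "group_center G" and ?W = "group_center H"
  interpret N: normal ?W H by (rule B.normal_group_center)
  interpret Q: group "H Mod ?W" by (rule N.factorgroup_is_group)
  \<comment> \<open>Any element of \<open>H\<close> sharing coordinates with \<open>u\<close> will
    do, as its coset does not depend on the choice by \<open>F_eq\<close>.\<close>
  define f where "f u = (SOME v. \<exists>i j. A.coord u i j \<and> B.coord v i j)" for u
  define F where "F u = ?W #>\<^bsub>H\<^esub> f u" for u
  have F_eq: "F u = ?W #>\<^bsub>H\<^esub> v" if u: "A.coord u i j" and v: "B.coord v i j" for u v i j
  proof -
    have "\<exists>k l. A.coord u k l \<and> B.coord (f u) k l"
      unfolding f_def by (rule someI_ex) (use u v in blast)
    then obtain k l where kl: "A.coord u k l" "B.coord (f u) k l" by blast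
    have "[k = i] (mod q) \<and> [l = j] (mod q)" using A.rcos_center_eq_iff_coord[OF kl(1) u] by simp
    then show ?thesis using B.rcos_center_eq_iff_coord[OF kl(2) v] by (simp add: F_def)
  qed
  have F_carrier: "F u \<in> carrier (H Mod ?W)" and ex_B: "\<exists>v i j. A.coord u i j \<and> B.coord v i j"
    if u: "u \<in> carrier G" for u
  proof -
    obtain i j where ij: "A.coord u i j" using A.ex_coord[OF u] by blast
    have v: "B.coord (y [^]\<^bsub>H\<^esub> i \<otimes>\<^bsub>H\<^esub> h [^]\<^bsub>H\<^esub> j) i j" by (rule B.coord_pow)
    then show "\<exists>v i j. A.coord u i j \<and> B.coord v i j" using ij by blast
    show "F u \<in> carrier (H Mod ?W)"
      using F_eq[OF ij v] B.coord_closed[OF v] by (auto simp: FactGroup_def RCOSETS_def)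
  qed
  have "F \<in> hom G (H Mod ?W)"
  proof (rule homI)
    fix u u' assume u: "u \<in> carrier G" "u' \<in> carrier G"
    obtain v i j where v: "A.coord u i j" "B.coord v i j" using ex_B[OF u(1)] by blast
    obtain v' k l where v': "A.coord u' k l" "B.coord v' k l" using ex_B[OF u(2)] by blast
    have "F (u \<otimes>\<^bsub>G\<^esub> u') = ?W #>\<^bsub>H\<^esub> (v \<otimes>\<^bsub>H\<^esub> v')"
      using F_eq[OF A.coord_mult[OF v(1) v'(1)] B.coord_mult[OF v(2) v'(2)]] .
    then show "F (u \<otimes>\<^bsub>G\<^esub> u') = F u \<otimes>\<^bsub>H Mod ?W\<^esub> F u'"
      using F_eq[OF v] F_eq[OF v'] N.rcos_sum B.coord_closed[OF v(2)] B.coord_closed[OF v'(2)]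
      by (simp add: FactGroup_def)
  qed (rule F_carrier)
  then interpret F: group_hom G "H Mod ?W" F
    by (simp add: group_hom_def group_hom_axioms_def A.is_group Q.is_group)
  have F_iff: "F u = F u' \<longleftrightarrow> ?Z #>\<^bsub>G\<^esub> u = ?Z #>\<^bsub>G\<^esub> u'" if u: "u \<in> carrier G" "u' \<in> carrier G" for u u'
  proof -
    obtain v i j where v: "A.coord u i j" "B.coord v i j" using ex_B[OF u(1)] by blast
    obtain v' k l where v': "A.coord u' k l" "B.coord v' k l" using ex_B[OF u(2)] by blast
    show ?thesis
      unfolding F_eq[OF v] F_eq[OF v'] B.rcos_center_eq_iff_coord[OF v(2) v'(2)]
        A.rcos_center_eq_iff_coord[OF v(1) v'(1)] ..
  qed
  have ker: "kernel G (H Mod ?W) F = ?Z"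
  proof -
    have "F u = \<one>\<^bsub>H Mod ?W\<^esub> \<longleftrightarrow> u \<in> ?Z" if u: "u \<in> carrier G" for u
      using F_iff[OF A.one_closed u] A.rcos_center_eq_iff[OF A.one_closed u] u F.hom_one by auto
    then show ?thesis using A.group_center_closed by (auto simp: kernel_def)
  qed
  have surj: "F ` carrier G = carrier (H Mod ?W)"
  proof
    show "carrier (H Mod ?W) \<subseteq> F ` carrier G"
    proof
      fix D assume "D \<in> carrier (H Mod ?W)"
      then obtain v where v: "v \<in> carrier H" "D = ?W #>\<^bsub>H\<^esub> v" by (auto simp: FactGroup_def RCOSETS_def)
      obtain i j where ij: "B.coord v i j" using B.ex_coord[OF v(1)] by blast
      have "D = F (x [^]\<^bsub>G\<^esub> i \<otimes>\<^bsub>G\<^esub> g [^]\<^bsub>G\<^esub> j)" using F_eq[OF A.coord_pow ij] v by simp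
      then show "D \<in> F ` carrier G" using A.coord_closed[OF A.coord_pow] by blast
    qed
  qed (use F_carrier in blast)
  \<comment> \<open>The map of the first isomorphism theorem: \<open>F\<close> is constant on each
    coset \<open>D\<close>, so its image there is a singleton.\<close>
  define P where "P D = the_elem (F ` D)" for D
  have P: "P \<in> iso (G Mod ?Z) (H Mod ?W)"
    using F.FactGroup_iso_set[OF surj] unfolding ker P_def .
  have P_eq: "P (?Z #>\<^bsub>G\<^esub> u) = F u" if u: "u \<in> carrier G" for u
  proof -
    have "F w = F u" if w: "w \<in> ?Z #>\<^bsub>G\<^esub> u" for w
    proof -
      have "w \<in> carrier G" using w u A.group_center_closed by (auto simp: r_coset_def)
      moreover have "?Z #>\<^bsub>G\<^esub> u = ?Z #>\<^bsub>G\<^esub> w"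
        by (rule A.repr_independence[OF w u A.subgroup_group_center])
      ultimately show ?thesis using F_iff[OF _ u] by metis
    qed
    moreover have "u \<in> ?Z #>\<^bsub>G\<^esub> u" using A.rcos_self[OF u A.subgroup_group_center] .
    ultimately have "F ` (?Z #>\<^bsub>G\<^esub> u) = {F u}" by blast
    then show ?thesis by (simp add: P_def)
  qed
  \<comment> \<open>The chosen exponent is unique modulo \<open>q\<close>, which is also the order
    of \<open>B.c\<close>.\<close>
  define R where "R d = B.c [^]\<^bsub>H\<^esub> (SOME m::int. d = A.c [^]\<^bsub>G\<^esub> m)" for d
  have R_eq: "R (A.c [^]\<^bsub>G\<^esub> m) = B.c [^]\<^bsub>H\<^esub> m" for m :: int
  proof -
    have "A.c [^]\<^bsub>G\<^esub> m = A.c [^]\<^bsub>G\<^esub> (SOME n::int. A.c [^]\<^bsub>G\<^esub> m = A.c [^]\<^bsub>G\<^esub> n)"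
      by (rule someI) (rule refl)
    then show ?thesis unfolding R_def A.c_int_pow_eq_iff B.c_int_pow_eq_iff by (rule cong_sym)
  qed
  have R: "R \<in> iso (G\<lparr>carrier := derived G (carrier G)\<rparr>) (H\<lparr>carrier := derived H (carrier H)\<rparr>)"
  proof (rule isoI)
    show "R \<in> hom (G\<lparr>carrier := derived G (carrier G)\<rparr>) (H\<lparr>carrier := derived H (carrier H)\<rparr>)"
      unfolding A.derived_eq B.derived_eq
      by (rule homI) (auto simp: R_eq A.int_pow_mult[OF A.c_closed, symmetric] B.int_pow_mult[OF B.c_closed])
    have "inj_on R (range (\<lambda>m::int. A.c [^]\<^bsub>G\<^esub> m))"
      by (rule inj_onI) (auto simp: R_eq A.c_int_pow_eq_iff B.c_int_pow_eq_iff)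
    moreover have "R ` range (\<lambda>m::int. A.c [^]\<^bsub>G\<^esub> m) = range (\<lambda>m::int. B.c [^]\<^bsub>H\<^esub> m)"
      by (simp add: image_image R_eq)
    ultimately show "bij_betw R (carrier (G\<lparr>carrier := derived G (carrier G)\<rparr>))
        (carrier (H\<lparr>carrier := derived H (carrier H)\<rparr>))"
      by (simp add: bij_betw_def A.derived_eq B.derived_eq)
  qed
  have "R (commutator G g\<^sub>1 g\<^sub>2) = commutator H h\<^sub>1 h\<^sub>2"
    if g: "g\<^sub>1 \<in> carrier G" "g\<^sub>2 \<in> carrier G" and h: "h\<^sub>1 \<in> carrier H" "h\<^sub>2 \<in> carrier H"
      and eq: "P (?Z #>\<^bsub>G\<^esub> g\<^sub>1) = ?W #>\<^bsub>H\<^esub> h\<^sub>1" "P (?Z #>\<^bsub>G\<^esub> g\<^sub>2) = ?W #>\<^bsub>H\<^esub> h\<^sub>2" for g\<^sub>1 g\<^sub>2 h\<^sub>1 h\<^sub>2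
  proof -
    \<comment> \<open>Matching cosets only make coordinates congruent. This suffices, since the
      determinant occurs as an exponent of \<open>B.c\<close>.\<close>
    have *: "\<exists>i j k l. A.coord u i j \<and> B.coord v k l \<and> [i = k] (mod q) \<and> [j = l] (mod q)"
      if u: "u \<in> carrier G" and v: "v \<in> carrier H" and uv: "P (?Z #>\<^bsub>G\<^esub> u) = ?W #>\<^bsub>H\<^esub> v" for u v
    proof -
      obtain w i j where w: "A.coord u i j" "B.coord w i j" using ex_B[OF u] by blast
      obtain k l where kl: "B.coord v k l" using B.ex_coord[OF v] by blast
      have "?W #>\<^bsub>H\<^esub> w = ?W #>\<^bsub>H\<^esub> v" using F_eq[OF w] P_eq[OF u] uv by simp
      then show ?thesis using B.rcos_center_eq_iff_coord[OF w(2) kl] w kl by blast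
    qed
    obtain i j i' j' where 1: "A.coord g\<^sub>1 i j" "B.coord h\<^sub>1 i' j'" "[i = i'] (mod q)" "[j = j'] (mod q)"
      using *[OF g(1) h(1) eq(1)] by blast
    obtain k l k' l' where 2: "A.coord g\<^sub>2 k l" "B.coord h\<^sub>2 k' l'" "[k = k'] (mod q)" "[l = l'] (mod q)"
      using *[OF g(2) h(2) eq(2)] by blast
    have "[int i * int l - int j * int k = int i' * int l' - int j' * int k'] (mod int q)"
      using 1 2 by (intro cong_diff cong_mult) (simp_all add: cong_int_iff)
    then show ?thesis
      unfolding A.commutator_coord[OF 1(1) 2(1)] B.commutator_coord[OF 1(2) 2(2)] R_eq B.c_int_pow_eq_iff .
  qed
  then show ?thesis unfolding isoclinic_def using P R by blast
qed

section \<open>The cases 5, 7 and 9\<close>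

text \<open>The values of \<open>n\<close> enter twice: \<open>n \<le> 9\<close> makes proper
  centralizers abelian, and \<open>n - 2\<close> is one of the primes 3, 5, 7.\<close>

lemma (in group) ex_prime_two_generated:
  assumes n: "n \<in> {5, 7, 9}" and nil: "nilpotent_group G" and "n_centralizer n G"
  shows "\<exists>x g. prime_two_generated G (n - 2) x g"
proof -
  have fin: "finite (Cent G)" and card: "card (Cent G) = n" using assms by (auto simp: n_centralizer_def)
  have prime: "Factorial_Ring.prime (n - 2)"
  proof -
    have "n - 2 \<in> {3, 5, 7}" using n by auto
    then show ?thesis by auto
  qed
  have card9: "card (Cent G) \<le> 9" and card2: "card (Cent G) = (n - 2) + 2" using n card by auto
  show ?thesis
    by (rule ex_prime_two_generated_if_abelian_centralizers[OF fin _ prime card2 nil])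
      (rule centralizer_abelian[OF fin card9])
qed

theorem mainTheorem6:
  fixes G :: "('a, 'c) monoid_scheme" and H :: "('b, 'd) monoid_scheme" and n :: nat
  assumes "n \<in> {5, 7, 9}"
    and "group G" and "nilpotent_group G" and "n_centralizer n G"
    and "group H" and "nilpotent_group H" and "n_centralizer n H"
  shows "isoclinic G H"
proof -
  obtain x g where "prime_two_generated G (n - 2) x g"
    using group.ex_prime_two_generated[OF assms(2,1,3,4)] by blast
  moreover obtain y h where "prime_two_generated H (n - 2) y h"
    using group.ex_prime_two_generated[OF assms(5,1,6,7)] by blast
  ultimately show ?thesis by (rule isoclinic_if_prime_two_generated)
qed

end
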